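(* Let $k$ be a positive integer. (1) Let $t\ge 2$ be an integer and $D=\{t^i: i\in\mathbb{N}\}$. Then $m^\infty_{D,\mathbb{N}}(k)\le m_{\mathcal{T}_3}(k)$. (2) Let $p,q>1$ be coprime integers, $D=\{p^iq^j: i,j\in\mathbb{N}\}$, and let $M\subseteq\mathbb{N}$ contain at most one element of every residue class modulo $pq$. Then $m^\infty_{D,M}(k)\le |M|\,(m_{\mathcal{T}_3}(k)-1)+1$. Moreover, if $M=\{0\}$, then equality holds: $m^\infty_{D,\{0\}}(k)=m_{\mathcal{T}_3}(k)$. (3) Let $k\ge 2$, let $p_1,p_2,p_3>1$ be pairwise coprime integers and $D=\{p_1^{j_1}p_2^{j_2}p_3^{j_3}: j_1,j_2,j_3\in\mathbb{N}\}$. Then $m^\infty_{D,\{0\}}(k)=\infty$.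
   Context: $\mathbb{N}$ denotes the natural numbers including $0$. For $D,M\subseteq\mathbb{N}$, $\mathcal{A}^\infty_{D,M}$ is the family of hypergraphs $A$ with finite vertex set $S\subseteq\mathbb{N}$ each of whose edges has the form $\{a+nd: n\in\mathbb{N}\}\cap S$, where $d\in D$ and $a\in\mathbb{N}$ are such that $a-md\in M$ for some $m\in\mathbb{N}$ (intersection of $S$ with an infinite arithmetic progression with difference in $D$ which, extended backwards, meets $M$). The family $\mathcal{T}_3$ consists of hypergraphs $H=(V,E)$ with $V\subset\mathbb{R}^3$ finite and every edge of the form $V\cap\{(x,y,z): x_0\le x,\ y\le y_0,\ z\le z_0\}$ for some $x_0,y_0,z_0\in\mathbb{R}$. A polychromatic $k$-coloring of a hypergraph is a coloring of its vertices with $k$ colors such that every edge contains a vertex of each color. $H_{\ge m}$ is obtained from $H$ by deleting all edges of size less than $m$. For a hypergraph family $\mathcal{H}$, $m_{\mathcal{H}}(k)$ is the smallest positive integer $m$ such that $H_{\ge m}$ has a polychromatic $k$-coloring for every $H\in\mathcal{H}$ ($\infty$ if none exists); $m^\infty_{D,M}(k):=m_{\mathcal{A}^\infty_{D,M}}(k)$. *)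

theory Defs
  imports Complex_Main "HOL-Library.Extended_Nat" "HOL-Number_Theory.Cong"
begin

type_synonym 'v hypergraph = "'v set \<times> 'v set set"

definition restrict_edges :: "'v hypergraph \<Rightarrow> nat \<Rightarrow> 'v hypergraph" where
  "restrict_edges H m = (fst H, {e \<in> snd H. m \<le> card e})"

definition polychromatic :: "nat \<Rightarrow> 'v hypergraph \<Rightarrow> ('v \<Rightarrow> nat) \<Rightarrow> bool" where
  "polychromatic k H c \<longleftrightarrow>
     (\<forall>v\<in>fst H. c v < k) \<and> (\<forall>e\<in>snd H. \<forall>i<k. \<exists>v\<in>e. c v = i)"

text \<open>The infimum is the least element of the set, and it is \<open>\<infinity>\<close> if the set is empty.\<close>

definition poly_number :: "'v hypergraph set \<Rightarrow> nat \<Rightarrow> enat" where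
  "poly_number \<H> k =
     Inf {enat m | m. 0 < m \<and> (\<forall>H\<in>\<H>. \<exists>c. polychromatic k (restrict_edges H m) c)}"

text \<open>
  The condition that \<open>a - m * d\<close> lies in \<open>M\<close> is an integer one; it is written as
  \<open>a = b + m * d\<close> with \<open>b \<in> M\<close> because subtraction on \<^typ>\<open>nat\<close> truncates.
\<close>

definition AP_inf :: "nat set \<Rightarrow> nat set \<Rightarrow> nat hypergraph set" where
  "AP_inf D M =
     {(S, E). finite S \<and>
        (\<forall>e\<in>E. \<exists>d\<in>D. \<exists>a. (\<exists>m. \<exists>b\<in>M. a = b + m * d) \<and> e = {a + n * d | n. True} \<inter> S)}"

definition T3 :: "(real \<times> real \<times> real) hypergraph set" where
  "T3 =
     {(V, E). finite V \<and>
        (\<forall>e\<in>E. \<exists>x0 y0 z0. e = V \<inter> {(x, y, z). x0 \<le> x \<and> y \<le> y0 \<and> z \<le> z0})}"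

end

theory Submission
  imports Defs
begin

text \<open>
  Process the vertices by size: an edge becomes an octant as soon as its residue conditions are
  lower sets in two linear orders. For \<open>D = {t ^ i}\<close> an order in which all residue classes are
  intervals, taken in both directions, does this. For \<open>D = {p ^ i * q ^ j}\<close> and \<open>M = {0}\<close> the orders
  are the reversed \<open>p\<close>-adic and \<open>q\<close>-adic valuations, and by coprimality all pairs of orders occur.
  For general \<open>M\<close> the vertices are split into \<open>card M\<close> groups, each of them embedded into space in such a
  way that every edge is a union of at most \<open>card M\<close> octants; then the pigeonhole principle applies.
  With three coprime bases one more order is available, which suffices for the \<open>m\<close>-ary tree with the sets of
  siblings and the root-to-leaf paths as edges. This hypergraph has no polychromatic coloring.
\<close>

section \<open>Octants and orders with intervals\<close>

text \<open>An octant gives one bound on each of three coordinates, and the size of the vertices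
  uses up the first. For a single base, an interval of classes costs the other two. For two bases
  and general \<open>M\<close>, an edge asks for an interval among the p-classes and for another
  among the q-classes, four bounds in all, so both orders have to share one line and one pair of
  coordinates. For this, every vertex gets two adjacent positions, one of either kind. Adjacency
  forces a parity condition on the ends of intervals and makes the placement of the q-order depend
  on the vertex; the resulting shifts are the reason for the groups and for the factor
  \<open>card M\<close>. In the other direction, octants are realized by numbers because the
  exponents of the bases can be prescribed while a remaining factor, coprime to the bases, makes the
  numbers grow in any given order.\<close>

definition threshold :: "nat \<Rightarrow> 'v hypergraph set \<Rightarrow> nat \<Rightarrow> bool" where
  "threshold k \<H> m \<longleftrightarrow> (\<forall>H\<in>\<H>. \<exists>c. polychromatic k (restrict_edges H m) c)"

lemma threshold_imp_poly_number_le: "0 < m \<Longrightarrow> threshold k \<H> m \<Longrightarrow> poly_number \<H> k \<le> enat m"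
  unfolding poly_number_def threshold_def by (rule Inf_lower) auto

lemma poly_number_cases:
  obtains "poly_number \<H> k = \<infinity>"
  | m where "poly_number \<H> k = enat m" "0 < m" "threshold k \<H> m"
proof -
  let ?A = "{enat m | m. 0 < m \<and> threshold k \<H> m}"
  have eq: "poly_number \<H> k = Inf ?A"
    by (simp add: poly_number_def threshold_def)
  show ?thesis
  proof (cases "?A = {}")
    case True
    then show ?thesis using that(1) eq by (simp add: top_enat_def del: Collect_empty_eq)
  next
    case False
    then have "Inf ?A \<in> ?A"
      unfolding Inf_enat_def by (smt (verit) LeastI ex_in_conv)
    then show ?thesis using that(2) eq by auto
  qed
qed

lemma poly_number_mono:
  assumes "\<And>m. 0 < m \<Longrightarrow> threshold k \<H>' m \<Longrightarrow> threshold k \<H> m"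
  shows "poly_number \<H> k \<le> poly_number \<H>' k"
  by (cases rule: poly_number_cases[of \<H>' k]) (auto intro: assms threshold_imp_poly_number_le)

text \<open>Vertices are colored group by group; an edge of size greater than \<open>L * (m - 1)\<close> contains
  a piece of size at least \<open>m\<close>, which is an octant of one group.\<close>

lemma polychromatic_by_octants:
  fixes y z :: "nat \<Rightarrow> real" and g :: "nat \<Rightarrow> int"
  assumes threshold: "threshold k T3 m" and "0 < m" and fin: "finite S"
    and cover: "\<And>e. e \<in> E \<Longrightarrow> \<exists>I :: int set. \<exists>\<O>. finite I \<and> card I \<le> L \<and> e = (\<Union>i\<in>I. \<O> i) \<and>
      (\<forall>i\<in>I. \<exists>\<gamma> x0 y0 z0. \<O> i = {v\<in>S. g v = \<gamma> \<and> x0 \<le> real v \<and> y v \<le> y0 \<and> z v \<le> z0})"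
  shows "\<exists>c. polychromatic k (restrict_edges (S, E) (L * (m - 1) + 1)) c"
proof -
  define \<phi> where "\<phi> v = (real v, y v, z v)" for v
  have inj: "inj_on \<phi> A" for A by (auto simp: inj_on_def \<phi>_def)
  define V where "V \<gamma> = \<phi> ` {v\<in>S. g v = \<gamma>}" for \<gamma>
  define oct where "oct x0 y0 z0 = {(x, y, z). x0 \<le> x \<and> y \<le> y0 \<and> z \<le> z0}" for x0 y0 z0 :: real
  define H where "H \<gamma> = (V \<gamma>, {V \<gamma> \<inter> oct x0 y0 z0 | x0 y0 z0. True})" for \<gamma>
  have "H \<gamma> \<in> T3" for \<gamma>
    using fin by (auto simp: H_def T3_def V_def oct_def)
  then have "\<forall>\<gamma>. \<exists>c. polychromatic k (restrict_edges (H \<gamma>) m) c"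
    using threshold by (auto simp: threshold_def)
  then obtain c where c: "\<And>\<gamma>. polychromatic k (restrict_edges (H \<gamma>) m) (c \<gamma>)"
    by metis
  let ?c = "\<lambda>v. c (g v) (\<phi> v)"
  have "?c v < k" if "v \<in> S" for v
    using c[of "g v"] that by (auto simp: polychromatic_def restrict_edges_def H_def V_def)
  moreover have "\<exists>v\<in>e. ?c v = j" if e: "e \<in> E" "L * (m - 1) + 1 \<le> card e" and j: "j < k" for e j
  proof -
    obtain I :: "int set" and \<O> where I: "finite I" "card I \<le> L" "e = (\<Union>i\<in>I. \<O> i)"
      and \<O>: "\<forall>i\<in>I. \<exists>\<gamma> x0 y0 z0. \<O> i = {v\<in>S. g v = \<gamma> \<and> x0 \<le> real v \<and> y v \<le> y0 \<and> z v \<le> z0}"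
      using cover[OF e(1)] by blast
    have "\<exists>i\<in>I. m \<le> card (\<O> i)"
    proof (rule ccontr)
      assume "\<not> ?thesis"
      then have "card (\<O> i) \<le> m - 1" if "i \<in> I" for i using that by force
      then have "(\<Sum>i\<in>I. card (\<O> i)) \<le> card I * (m - 1)"
        using sum_bounded_above[of I "\<lambda>i. card (\<O> i)" "m - 1"] by simp
      moreover have "card e \<le> (\<Sum>i\<in>I. card (\<O> i))"
        unfolding I(3) by (rule card_UN_le[OF I(1)])
      moreover have "card I * (m - 1) \<le> L * (m - 1)" using I(2) by simp
      ultimately show False using e(2) by linarith
    qed
    then obtain i where i: "i \<in> I" "m \<le> card (\<O> i)" by blast
    then obtain \<gamma> x0 y0 z0 where
      O: "\<O> i = {v\<in>S. g v = \<gamma> \<and> x0 \<le> real v \<and> y v \<le> y0 \<and> z v \<le> z0}"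
      using \<O> by blast
    have "\<phi> ` \<O> i = V \<gamma> \<inter> oct x0 y0 z0"
      unfolding O V_def oct_def \<phi>_def by auto
    moreover have "card (\<phi> ` \<O> i) = card (\<O> i)" by (rule card_image[OF inj])
    ultimately have "\<phi> ` \<O> i \<in> snd (restrict_edges (H \<gamma>) m)"
      using i(2) by (auto simp: restrict_edges_def H_def)
    then have "\<exists>v\<in>\<phi> ` \<O> i. c \<gamma> v = j"
      using c[of \<gamma>] j by (auto simp: polychromatic_def)
    then show ?thesis using O I(3) i(1) by auto
  qed
  ultimately show ?thesis
    by (intro exI[of _ ?c]) (auto simp: polychromatic_def restrict_edges_def)
qed

section \<open>Orders in which all residue classes are intervals\<close>

definition class_of :: "nat set \<Rightarrow> nat \<Rightarrow> nat \<Rightarrow> nat set" where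
  "class_of X d b = {x\<in>X. [x = b] (mod d)}"

text \<open>In \<open>blocks t N i \<delta> xs\<close> the list \<open>xs\<close> starts at position \<open>\<delta>\<close>, and classes of even size have to
  start at even positions.\<close>

definition blocks :: "nat \<Rightarrow> nat \<Rightarrow> nat \<Rightarrow> nat \<Rightarrow> nat list \<Rightarrow> bool" where
  "blocks t N i \<delta> xs \<longleftrightarrow> distinct xs \<and>
     (\<forall>j. i \<le> j \<longrightarrow> j \<le> N \<longrightarrow> (\<forall>b\<in>set xs. \<exists>us vs ws. xs = us @ vs @ ws \<and>
        set vs = class_of (set xs) (t ^ j) b \<and> (even (length vs) \<longrightarrow> even (\<delta> + length us))))"

lemma blocksE:
  assumes "blocks t N i \<delta> xs" "i \<le> j" "j \<le> N" "b \<in> set xs"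
  obtains us vs ws where "xs = us @ vs @ ws" "set vs = class_of (set xs) (t ^ j) b"
    "even (length vs) \<longrightarrow> even (\<delta> + length us)"
  using assms unfolding blocks_def by blast

text \<open>Elements that are incongruent modulo \<open>t ^ i\<close> stay so modulo higher powers,
  so every class of level at least \<open>i\<close> lies in one of the two lists.\<close>

lemma blocks_append:
  assumes "blocks t N i \<delta> xs" "blocks t N i (\<delta> + length xs) ys"
    and sep: "\<And>x y. x \<in> set xs \<Longrightarrow> y \<in> set ys \<Longrightarrow> \<not> [x = y] (mod t ^ i)"
  shows "blocks t N i \<delta> (xs @ ys)"
proof -
  have sep': "\<not> [x = y] (mod t ^ j)" if "x \<in> set xs" "y \<in> set ys" "i \<le> j" for x y j
    using sep[OF that(1,2)] cong_dvd_modulus_nat[of x y "t ^ j" "t ^ i"] that(3) le_imp_power_dvd by blast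
  have "set xs \<inter> set ys = {}" using sep by force
  then have "distinct (xs @ ys)" using assms(1,2) by (simp add: blocks_def)
  moreover have "\<exists>us vs ws. xs @ ys = us @ vs @ ws \<and>
      set vs = class_of (set (xs @ ys)) (t ^ j) b \<and> (even (length vs) \<longrightarrow> even (\<delta> + length us))"
    if j: "i \<le> j" "j \<le> N" and b: "b \<in> set (xs @ ys)" for j b
  proof (cases "b \<in> set xs")
    case True
    then obtain us vs ws where *: "xs = us @ vs @ ws" "set vs = class_of (set xs) (t ^ j) b"
      "even (length vs) \<longrightarrow> even (\<delta> + length us)"
      using assms(1) j unfolding blocks_def by blast
    have "class_of (set (xs @ ys)) (t ^ j) b = class_of (set xs) (t ^ j) b"
      using sep'[OF True _ j(1)] by (auto simp: class_of_def dest: cong_sym)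
    then have "set vs = class_of (set (xs @ ys)) (t ^ j) b" using *(2) by (simp only:)
    moreover have "xs @ ys = us @ vs @ ws @ ys" by (simp add: *(1))
    ultimately show ?thesis using *(3) by blast
  next
    case False
    then have b': "b \<in> set ys" using b by simp
    then obtain us vs ws where *: "ys = us @ vs @ ws" "set vs = class_of (set ys) (t ^ j) b"
      "even (length vs) \<longrightarrow> even (\<delta> + length xs + length us)"
      using assms(2) j unfolding blocks_def by blast
    have "class_of (set (xs @ ys)) (t ^ j) b = class_of (set ys) (t ^ j) b"
      using sep'[OF _ b' j(1)] by (auto simp: class_of_def)
    then have "set vs = class_of (set (xs @ ys)) (t ^ j) b" using *(2) by (simp only:)
    moreover have "xs @ ys = (xs @ us) @ vs @ ws" by (simp add: *(1))
    moreover have "even (length vs) \<longrightarrow> even (\<delta> + length (xs @ us))"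
      using *(3) by (simp add: add.assoc)
    ultimately show ?thesis by blast
  qed
  ultimately show ?thesis by (simp add: blocks_def)
qed

text \<open>At level \<open>i\<close> the only class is the whole list, so just the parity of its
  start has to be checked.\<close>

lemma blocks_one_class:
  assumes "blocks t N (Suc i) \<delta> xs" "\<And>x. x \<in> set xs \<Longrightarrow> [x = b] (mod t ^ i)"
    and "even (length xs) \<Longrightarrow> even \<delta>"
  shows "blocks t N i \<delta> xs"
proof -
  have "\<exists>us vs ws. xs = us @ vs @ ws \<and>
      set vs = class_of (set xs) (t ^ i) b' \<and> (even (length vs) \<longrightarrow> even (\<delta> + length us))"
    if "b' \<in> set xs" for b'
  proof -
    have "class_of (set xs) (t ^ i) b' = set xs"
      using assms(2) that by (auto simp: class_of_def intro: cong_trans cong_sym)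
    then show ?thesis using assms(3) by (intro exI[of _ "[]"] exI[of _ xs]) auto
  qed
  then show ?thesis
    using assms(1) unfolding blocks_def by (metis le_antisym not_less_eq_eq)
qed

text \<open>The even children of a class have to start at even positions, so they precede the odd ones,
  except that one odd child comes first if the class itself starts at an odd position.\<close>

lemma blocks_exist:
  assumes "finite X" "odd (card X) \<or> even \<delta>"
  shows "\<exists>xs. set xs = X \<and> blocks t N i \<delta> xs"
  using assms
proof (induction "Suc N - i" arbitrary: i X \<delta>)
  case 0
  then show ?case
    using finite_distinct_list[of X] by (force simp: blocks_def)
next
  case (Suc d)
  note outer = Suc.hyps(1)
  have d: "d = Suc N - Suc i" using Suc.hyps(2) by simp
  \<comment> \<open>The outer induction moves from fine levels to coarse ones. The inner one splits
    off a single class \<open>C\<close> modulo \<open>t ^ i\<close>, arranged by the outer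
    hypothesis; the rest \<open>R\<close> consists of the other classes.\<close>
  show ?case using Suc.prems
  proof (induction X arbitrary: \<delta> rule: finite_psubset_induct)
    case (psubset X)
    show ?case
    proof (cases "X = {}")
      case True
      then show ?thesis by (auto simp: blocks_def)
    next
      case False
      then obtain b where b: "b \<in> X" by blast
      define C where "C = class_of X (t ^ i) b"
      define R where "R = X - C"
      have CX: "C \<subseteq> X" "b \<in> C" using b by (auto simp: C_def class_of_def)
      have fin: "finite C" "finite R" using psubset(1) CX(1) by (auto simp: R_def finite_subset)
      have X: "X = C \<union> R" "card X = card C + card R"
        using CX(1) fin by (auto simp: R_def card_Un_disjoint[symmetric] intro!: arg_cong[of _ _ card])
      have sep: "\<not> [x = y] (mod t ^ i)" if "x \<in> C" "y \<in> R" for x y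
        using that by (auto simp: C_def R_def class_of_def intro: cong_trans cong_sym)
      have Cl: "\<exists>xs. set xs = C \<and> length xs = card C \<and> blocks t N i \<delta>' xs"
        if C: "odd (card C) \<or> even \<delta>'" for \<delta>'
      proof -
        obtain xs where xs: "set xs = C" "blocks t N (Suc i) \<delta>' xs"
          using outer[OF d fin(1) C] by blast
        then have len: "length xs = card C" by (auto simp: blocks_def distinct_card)
        have "blocks t N i \<delta>' xs"
          using C by (intro blocks_one_class[OF xs(2), of b]) (auto simp: xs(1) C_def class_of_def len[unfolded C_def class_of_def])
        then show ?thesis using xs len by blast
      qed
      have Rl: "\<exists>xs. set xs = R \<and> length xs = card R \<and> blocks t N i \<delta>' xs"
        if R: "odd (card R) \<or> even \<delta>'" for \<delta>'
      proof -
        have "R \<subset> X" using b CX by (auto simp: R_def)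
        then obtain xs where "set xs = R" "blocks t N i \<delta>' xs"
          using psubset.IH R by blast
        then show ?thesis by (auto simp: blocks_def distinct_card)
      qed
      show ?thesis
      proof (cases "(odd (card C) \<or> even \<delta>) \<and> (odd (card R) \<or> even (\<delta> + card C))")
        case True
        then obtain xs ys where "set xs = C" "length xs = card C" "blocks t N i \<delta> xs"
          "set ys = R" "blocks t N i (\<delta> + card C) ys"
          using Cl Rl by metis
        then show ?thesis
          using X sep by (intro exI[of _ "xs @ ys"] conjI blocks_append) auto
      next
        case False
        \<comment> \<open>Exactly one of \<open>C\<close> and \<open>R\<close> has even size here,
          and it would start at an odd position. Exchanging the two moves its start to an even
          position, while the odd one may start anywhere.\<close>
        then have "(odd (card R) \<or> even \<delta>) \<and> (odd (card C) \<or> even (\<delta> + card R))"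
          using psubset.prems X(2) by auto
        then obtain xs ys where "set ys = C" "length xs = card R" "blocks t N i \<delta> xs"
          "set xs = R" "blocks t N i (\<delta> + card R) ys"
          using Cl Rl by metis
        then show ?thesis
          using X sep by (intro exI[of _ "xs @ ys"] conjI blocks_append) (auto dest: cong_sym)
      qed
    qed
  qed
qed

text \<open>The parity clause is that of \<open>blocks\<close> in terms of ends: an interval that
  starts at an odd rank has odd size, hence ends at an odd rank.\<close>

lemma class_interval_order:
  assumes "finite X"
  obtains \<sigma> :: "nat \<Rightarrow> nat" where "bij_betw \<sigma> X {..<card X}"
    "\<And>i b. i \<le> N \<Longrightarrow> b \<in> X \<Longrightarrow> \<exists>l h. l \<le> h \<and> h < card X \<and> (odd l \<longrightarrow> odd h) \<and>
       class_of X (t ^ i) b = {x\<in>X. l \<le> \<sigma> x \<and> \<sigma> x \<le> h}"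
proof -
  obtain xs where xs: "set xs = X" "blocks t N 0 0 xs"
    using blocks_exist[OF assms, where \<delta> = 0 and t = t and N = N and i = 0] by auto
  have dist: "distinct xs" using xs(2) by (simp add: blocks_def)
  then have len: "length xs = card X" using distinct_card[OF dist] xs(1) by simp
  define \<sigma> where "\<sigma> = inv_into {..<length xs} ((!) xs)"
  have nth: "bij_betw ((!) xs) {..<length xs} X"
    using bij_betw_nth[OF dist refl xs(1)[symmetric]] .
  then have bij: "bij_betw \<sigma> X {..<card X}"
    unfolding \<sigma>_def len[symmetric] by (rule bij_betw_inv_into)
  have \<sigma>: "\<sigma> (xs ! a) = a" if "a < length xs" for a
    using nth that unfolding \<sigma>_def by (simp add: bij_betw_def)
  have "\<exists>l h. l \<le> h \<and> h < card X \<and> (odd l \<longrightarrow> odd h) \<and>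
       class_of X (t ^ i) b = {x\<in>X. l \<le> \<sigma> x \<and> \<sigma> x \<le> h}"
    if "i \<le> N" "b \<in> X" for i b
  proof -
    obtain us vs ws where dec: "xs = us @ vs @ ws" and vs_eq: "set vs = class_of X (t ^ i) b"
      and par: "even (length vs) \<longrightarrow> even (0 + length us)"
      using blocksE[OF xs(2) le0 \<open>i \<le> N\<close>, of b] \<open>b \<in> X\<close> unfolding xs(1) by blast
    have "b \<in> set vs" using vs_eq \<open>b \<in> X\<close> by (simp add: class_of_def)
    then have vs: "0 < length vs" by (cases vs) auto
    have len_dec: "length xs = length us + length vs + length ws" unfolding dec by simp
    let ?l = "length us" and ?h = "length us + length vs - 1"
    have nth_vs: "vs ! a = xs ! (length us + a)" if "a < length vs" for a
      using that unfolding dec by (simp add: nth_append)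
    have "x \<in> set vs \<longleftrightarrow> ?l \<le> \<sigma> x \<and> \<sigma> x \<le> ?h" if "x \<in> X" for x
    proof
      assume "x \<in> set vs"
      then obtain a where a: "a < length vs" "x = vs ! a" by (auto simp: in_set_conv_nth)
      then have "\<sigma> x = length us + a" using nth_vs \<sigma> len_dec by simp
      then show "?l \<le> \<sigma> x \<and> \<sigma> x \<le> ?h" using a(1) by linarith
    next
      assume bnd: "?l \<le> \<sigma> x \<and> \<sigma> x \<le> ?h"
      have "x \<in> set xs" using \<open>x \<in> X\<close> xs(1) by simp
      then obtain a where a: "a < length xs" "x = xs ! a" by (auto simp: in_set_conv_nth)
      then have "\<sigma> x = a" using \<sigma> by simp
      then have ge: "length us \<le> a" and lt: "a - length us < length vs"
        using bnd vs by linarith+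
      then have "x = vs ! (a - length us)" using a(2) nth_vs by simp
      then show "x \<in> set vs" using lt by simp
    qed
    then have "class_of X (t ^ i) b = {x\<in>X. ?l \<le> \<sigma> x \<and> \<sigma> x \<le> ?h}"
      unfolding vs_eq by (auto simp: class_of_def)
    moreover have "?l \<le> ?h" "?h < card X" "odd ?l \<longrightarrow> odd ?h"
    proof -
      obtain n where "length vs = Suc n" using vs by (cases "length vs") auto
      then show "?l \<le> ?h" "?h < card X" "odd ?l \<longrightarrow> odd ?h"
        using par len len_dec by auto
    qed
    ultimately show ?thesis by blast
  qed
  then show ?thesis using bij that by blast
qed

section \<open>Arbitrary vertices relative to the classes of the offsets\<close>

lemma cong_pow_mono: "[x = b] (mod t ^ j) \<Longrightarrow> i \<le> j \<Longrightarrow> [x = b] (mod t ^ i)" for x b t :: nat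
  using cong_dvd_modulus_nat le_imp_power_dvd by blast

text \<open>Here \<open>\<alpha> x\<close> is the largest \<open>i \<le> N\<close> for which \<open>x\<close> is congruent modulo \<open>t ^ i\<close> to an element
  of \<open>M\<close>, and \<open>lo x\<close>, \<open>hi x\<close> are the ends of the interval formed by these elements.\<close>

lemma class_coordinates:
  assumes fin: "finite M" and "M \<noteq> {}"
  obtains lo hi \<alpha> :: "nat \<Rightarrow> nat" and L H :: "nat \<Rightarrow> nat \<Rightarrow> nat" where
    "\<And>x. lo x < card M" "\<And>x. hi x < card M" "\<And>x. odd (lo x) \<Longrightarrow> odd (hi x)" "\<And>x. \<alpha> x \<le> N"
    "\<And>b i. b \<in> M \<Longrightarrow> i \<le> N \<Longrightarrow> H b i < card M"
    "\<And>b i. b \<in> M \<Longrightarrow> i \<le> N \<Longrightarrow> Suc (H b i) = L b i + card (class_of M (t ^ i) b)"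
    "\<And>b i x. b \<in> M \<Longrightarrow> i \<le> N \<Longrightarrow> [x = b] (mod t ^ i) \<longleftrightarrow>
       L b i \<le> lo x \<and> lo x \<le> H b i \<and> (lo x = L b i \<longrightarrow> i \<le> \<alpha> x)"
    "\<And>b i x. b \<in> M \<Longrightarrow> i \<le> N \<Longrightarrow> [x = b] (mod t ^ i) \<longleftrightarrow>
       L b i \<le> hi x \<and> hi x \<le> H b i \<and> (hi x = H b i \<longrightarrow> i \<le> \<alpha> x)"
proof -
  let ?C = "\<lambda>i b. class_of M (t ^ i) b"
  obtain \<sigma> where bij: "bij_betw \<sigma> M {..<card M}"
    and int: "\<And>i b. i \<le> N \<Longrightarrow> b \<in> M \<Longrightarrow> \<exists>l h. l \<le> h \<and> h < card M \<and> (odd l \<longrightarrow> odd h) \<and>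
       ?C i b = {x\<in>M. l \<le> \<sigma> x \<and> \<sigma> x \<le> h}"
    using class_interval_order[OF fin] by blast
  define P where "P b i l h \<longleftrightarrow> l \<le> h \<and> h < card M \<and> (odd l \<longrightarrow> odd h) \<and>
       ?C i b = {x\<in>M. l \<le> \<sigma> x \<and> \<sigma> x \<le> h}" for b i l h
  have "\<forall>b i. \<exists>l h. b \<in> M \<longrightarrow> i \<le> N \<longrightarrow> P b i l h"
    using int unfolding P_def by blast
  then obtain L H where "\<forall>b i. b \<in> M \<longrightarrow> i \<le> N \<longrightarrow> P b i (L b i) (H b i)"
    by metis
  then have LH: "L b i \<le> H b i \<and> H b i < card M \<and>
       (odd (L b i) \<longrightarrow> odd (H b i)) \<and> ?C i b = {x\<in>M. L b i \<le> \<sigma> x \<and> \<sigma> x \<le> H b i}"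
    if "b \<in> M" "i \<le> N" for b i using that unfolding P_def by blast
  have img: "\<sigma> ` ?C i b = {L b i..H b i}" if "b \<in> M" "i \<le> N" for b i
  proof -
    have "\<sigma> ` M = {..<card M}" using bij by (simp add: bij_betw_def)
    moreover have "\<sigma> ` {x\<in>M. L b i \<le> \<sigma> x \<and> \<sigma> x \<le> H b i} = {L b i..H b i} \<inter> \<sigma> ` M" by auto
    ultimately show ?thesis using LH[OF that] by auto
  qed
  have card: "Suc (H b i) = L b i + card (?C i b)" if "b \<in> M" "i \<le> N" for b i
  proof -
    have "inj_on \<sigma> (?C i b)"
      using bij by (auto simp: bij_betw_def class_of_def intro: inj_on_subset)
    then have "card (?C i b) = card {L b i..H b i}" using img[OF that] card_image by metis
    then show ?thesis using LH[OF that] by simp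
  qed
  define Q where "Q x b i \<longleftrightarrow> b \<in> M \<and> i \<le> N \<and> [x = b] (mod t ^ i) \<and>
      (\<forall>j\<le>N. \<forall>b'\<in>M. [x = b'] (mod t ^ j) \<longrightarrow> j \<le> i)" for x b i
  have "\<exists>b i. Q x b i" for x
  proof -
    let ?I = "{i. i \<le> N \<and> (\<exists>b\<in>M. [x = b] (mod t ^ i))}"
    have fin: "finite ?I" by (rule finite_subset[of _ "{..N}"]) auto
    have "?I \<noteq> {}" using \<open>M \<noteq> {}\<close> by (auto intro!: exI[of _ 0])
    then have "Max ?I \<in> ?I" by (rule Max_in[OF fin])
    then obtain b where "b \<in> M" "Max ?I \<le> N" "[x = b] (mod t ^ Max ?I)" by blast
    moreover have "j \<le> Max ?I" if "j \<le> N" "b' \<in> M" "[x = b'] (mod t ^ j)" for j b'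
      using that by (intro Max_ge[OF fin]) blast
    ultimately show ?thesis unfolding Q_def by blast
  qed
  then obtain rep \<alpha> where "\<And>x. Q x (rep x) (\<alpha> x)" by metis
  then have rep: "\<And>x. rep x \<in> M" "\<And>x. \<alpha> x \<le> N" "\<And>x. [x = rep x] (mod t ^ \<alpha> x)"
    and max: "\<And>x j b. j \<le> N \<Longrightarrow> b \<in> M \<Longrightarrow> [x = b] (mod t ^ j) \<Longrightarrow> j \<le> \<alpha> x"
    unfolding Q_def by blast+
  define lo where "lo x = L (rep x) (\<alpha> x)" for x
  define hi where "hi x = H (rep x) (\<alpha> x)" for x
  \<comment> \<open>Up to level \<open>\<alpha> x\<close> the vertex \<open>x\<close> shares the
    classes of \<open>rep x\<close>; at deeper levels up to \<open>N\<close> it is congruent to no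
    element of \<open>M\<close>.\<close>
  have cong_iff: "[x = b] (mod t ^ i) \<longleftrightarrow> i \<le> \<alpha> x \<and> ?C (\<alpha> x) (rep x) \<subseteq> ?C i b"
    if "b \<in> M" "i \<le> N" for b i x
  proof
    assume a: "[x = b] (mod t ^ i)"
    then have i: "i \<le> \<alpha> x" using max that by blast
    have "[y = b] (mod t ^ i)" if "[y = rep x] (mod t ^ \<alpha> x)" for y
      using cong_pow_mono[OF that i] cong_pow_mono[OF rep(3) i] a by (metis cong_sym cong_trans)
    then show "i \<le> \<alpha> x \<and> ?C (\<alpha> x) (rep x) \<subseteq> ?C i b" using i by (auto simp: class_of_def)
  next
    assume a: "i \<le> \<alpha> x \<and> ?C (\<alpha> x) (rep x) \<subseteq> ?C i b"
    moreover have "rep x \<in> ?C (\<alpha> x) (rep x)" using rep(1) by (simp add: class_of_def)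
    ultimately have "[rep x = b] (mod t ^ i)" unfolding class_of_def by blast
    then show "[x = b] (mod t ^ i)" using a cong_pow_mono[OF rep(3)] cong_trans by blast
  qed
  have nested: "?C j b' \<subseteq> ?C i b" if "y \<in> ?C j b'" "y \<in> ?C i b" "i \<le> j" for i j b b' y
  proof
    fix y' assume "y' \<in> ?C j b'"
    then have "y' \<in> M" "[y' = y] (mod t ^ j)"
      using that(1) by (auto simp: class_of_def intro: cong_trans cong_sym)
    then show "y' \<in> ?C i b"
      using that(2) cong_pow_mono[OF _ that(3)] by (auto simp: class_of_def intro: cong_trans)
  qed
  have bounds: "L b i \<le> \<sigma> y" "\<sigma> y \<le> H b i" if "y \<in> ?C i b" "b \<in> M" "i \<le> N" for y b i
    using LH[OF that(2,3)] that(1) by auto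
  have le: "lo x \<le> hi x" for x using LH[OF rep(1,2)] by (simp add: lo_def hi_def)
  have hi_x: "hi x < card M" "odd (lo x) \<Longrightarrow> odd (hi x)" for x
    using LH[OF rep(1,2)[of x]] by (auto simp: lo_def hi_def)
  have img_x: "\<sigma> ` ?C (\<alpha> x) (rep x) = {lo x..hi x}" for x
    using img[OF rep(1,2)] by (simp add: lo_def hi_def)
  have sub_iff: "?C (\<alpha> x) (rep x) \<subseteq> ?C i b \<longleftrightarrow> L b i \<le> lo x \<and> hi x \<le> H b i"
    if "b \<in> M" "i \<le> N" for b i x
  proof -
    have "?C (\<alpha> x) (rep x) \<subseteq> ?C i b \<longleftrightarrow> \<sigma> ` ?C (\<alpha> x) (rep x) \<subseteq> \<sigma> ` ?C i b"
    proof
      have inj: "inj_on \<sigma> M" and sub: "?C (\<alpha> x) (rep x) \<subseteq> M" "?C i b \<subseteq> M"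
        using bij by (auto simp: bij_betw_def class_of_def)
      assume *: "\<sigma> ` ?C (\<alpha> x) (rep x) \<subseteq> \<sigma> ` ?C i b"
      show "?C (\<alpha> x) (rep x) \<subseteq> ?C i b"
      proof
        fix y assume y: "y \<in> ?C (\<alpha> x) (rep x)"
        then obtain y' where "y' \<in> ?C i b" "\<sigma> y = \<sigma> y'" using * by blast
        then show "y \<in> ?C i b" using inj_onD[OF inj] sub y by (metis subsetD)
      qed
    qed (rule image_mono)
    then show ?thesis
      unfolding img[OF that] img_x using le[of x] by simp
  qed
  \<comment> \<open>Classes are nested or disjoint, so as soon as two of their intervals share a
    rank, the one of higher level lies in the other.\<close>
  have overlap: "i \<le> \<alpha> x \<Longrightarrow> L b i \<le> lo x \<and> hi x \<le> H b i"
    "\<not> i \<le> \<alpha> x \<Longrightarrow> lo x \<le> L b i \<and> H b i \<le> hi x"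
    if meet: "L b i \<le> u" "u \<le> H b i" "lo x \<le> u" "u \<le> hi x" and b: "b \<in> M" "i \<le> N" for b i x u
  proof -
    have "u \<in> \<sigma> ` ?C i b" "u \<in> \<sigma> ` ?C (\<alpha> x) (rep x)"
      unfolding img[OF b] img_x using meet by auto
    then obtain y y' where "y \<in> ?C i b" "y' \<in> ?C (\<alpha> x) (rep x)" "\<sigma> y = \<sigma> y'" by auto
    moreover have "inj_on \<sigma> M" using bij by (simp add: bij_betw_def)
    ultimately have y: "y \<in> ?C i b" "y \<in> ?C (\<alpha> x) (rep x)"
      unfolding class_of_def inj_on_def by auto
    show "L b i \<le> lo x \<and> hi x \<le> H b i" if "i \<le> \<alpha> x"
      using nested[OF y(2,1) that] sub_iff[OF b] by blast
    show "lo x \<le> L b i \<and> H b i \<le> hi x" if "\<not> i \<le> \<alpha> x"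
    proof -
      have "\<sigma> ` ?C i b \<subseteq> \<sigma> ` ?C (\<alpha> x) (rep x)" using nested[OF y] that by (intro image_mono) simp
      then show ?thesis unfolding img[OF b] img_x using LH[OF b] by simp
    qed
  qed
  have main: "[x = b] (mod t ^ i) \<longleftrightarrow> i \<le> \<alpha> x \<and> L b i \<le> lo x \<and> hi x \<le> H b i"
    if "b \<in> M" "i \<le> N" for b i x
    using cong_iff[OF that] sub_iff[OF that] by simp
  show thesis
  proof (rule that[of lo hi \<alpha> H L])
    fix b i x assume b: "b \<in> M" "i \<le> N"
    \<comment> \<open>One end suffices: if \<open>lo x\<close> lies in the interval of
      \<open>b\<close>, the two intervals meet. When \<open>i\<close> exceeds
      \<open>\<alpha> x\<close>, the interval of \<open>x\<close> is the outer one, which forces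
      \<open>lo x = L b i\<close>, and exactly this case is excluded by the tie-breaker. The other
      end is symmetric.\<close>
    show "[x = b] (mod t ^ i) \<longleftrightarrow> L b i \<le> lo x \<and> lo x \<le> H b i \<and> (lo x = L b i \<longrightarrow> i \<le> \<alpha> x)"
      using overlap[of b i "lo x" x] b main[OF b, of x] le[of x] by fastforce
    show "[x = b] (mod t ^ i) \<longleftrightarrow> L b i \<le> hi x \<and> hi x \<le> H b i \<and> (hi x = H b i \<longrightarrow> i \<le> \<alpha> x)"
      using overlap[of b i "hi x" x] b main[OF b, of x] le[of x] by fastforce
  qed (use LH rep(2) card hi_x le_less_trans[OF le hi_x(1)] in auto)
qed

section \<open>Coordinates for the set of offsets\<close>

text \<open>This is lexicographic comparison packed into one integer: the position counts in units
  of \<open>K\<close>, and a depth below \<open>K\<close> only breaks ties.\<close>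

lemma mult_diff_le_iff:
  fixes a b u v K :: int
  assumes "0 \<le> u" "u < K" "0 \<le> v" "v < K"
  shows "a * K - u \<le> b * K - v \<longleftrightarrow> a < b \<or> a = b \<and> v \<le> u"
proof (cases rule: linorder_cases[of a b])
  case less
  then have "(a + 1) * K \<le> b * K" using assms by (intro mult_right_mono) auto
  then show ?thesis using less assms by (simp add: algebra_simps)
next
  case greater
  then have "(b + 1) * K \<le> a * K" using assms by (intro mult_right_mono) auto
  then show ?thesis using greater assms by (simp add: algebra_simps)
qed auto

lemma mult_add_le_iff:
  fixes a b u v K :: int
  assumes "0 \<le> u" "u < K" "0 \<le> v" "v < K"
  shows "a * K + u \<le> b * K + v \<longleftrightarrow> a < b \<or> a = b \<and> u \<le> v"
  using mult_diff_le_iff[OF assms(3,4,1,2), of "- b" "- a"] by auto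

text \<open>Place the \<open>p\<close>-classes and, for every shift \<open>c\<close>, the \<open>q\<close>-classes of \<open>M\<close> as intervals on
  one line: the element of \<open>p\<close>-rank \<open>s\<close> at position \<open>s + s div 2 + 1\<close> and the element of
  \<open>q\<close>-rank \<open>r\<close> at \<open>3 * (r - c)\<close>. So every \<open>s\<close> has exactly one neighbor of the other kind, on the left
  if \<open>s\<close> is even and on the right if \<open>s\<close> is odd. A vertex lying at depth \<open>\<alpha> x\<close> in the \<open>p\<close>-class
  \<open>[lo x, hi x]\<close> and at depth \<open>\<beta> x\<close> in the \<open>q\<close>-class \<open>[lo' x, hi' x]\<close> gets the shift for which
  \<open>hi' x\<close> is the left neighbor of \<open>lo x\<close>, or \<open>lo' x\<close> the right neighbor of \<open>hi x\<close>.
  The coordinate \<open>y\<close> bounds positions from above, \<open>z\<close> from below, and the depths are tie-breakers.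
  Shifts congruent modulo \<open>card M\<close> share a group. A \<open>q\<close>-class of size \<open>l\<close> needs one octant for each
  of \<open>l + card M div 2\<close> shifts, hence the bound on the sizes of the \<open>q\<close>-classes.\<close>

lemma octant_coordinates:
  fixes M :: "nat set" and p q N :: nat
  defines "n \<equiv> card M"
  assumes fin: "finite M" and ne: "M \<noteq> {}"
    and small: "\<And>b. b \<in> M \<Longrightarrow> card (class_of M q b) \<le> (n + 1) div 2"
  obtains g c :: "nat \<Rightarrow> int" and y z :: "nat \<Rightarrow> real" where
    "\<And>x. g x \<in> {0..<int n}"
    "\<And>b i. b \<in> M \<Longrightarrow> i \<le> N \<Longrightarrow> \<exists>y0 z0. \<forall>x. [x = b] (mod p ^ i) \<longleftrightarrow> y x \<le> y0 \<and> z x \<le> z0"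
    "\<And>b j. b \<in> M \<Longrightarrow> 0 < j \<Longrightarrow> j \<le> N \<Longrightarrow> \<exists>I. finite I \<and> card I \<le> n \<and>
       (\<forall>x. [x = b] (mod q ^ j) \<longrightarrow> c x \<in> I) \<and>
       (\<forall>i\<in>I. \<exists>\<gamma> y0 z0. \<forall>x. [x = b] (mod q ^ j) \<and> c x = i \<longleftrightarrow>
          g x = \<gamma> \<and> y x \<le> y0 \<and> z x \<le> z0)"
proof -
  obtain lo hi \<alpha> L H where
    lohi: "\<And>x. lo x < n" "\<And>x. hi x < n" "\<And>x. odd (lo x) \<Longrightarrow> odd (hi x)" "\<And>x. \<alpha> x \<le> N"
    and P_lo: "\<And>b i x. b \<in> M \<Longrightarrow> i \<le> N \<Longrightarrow> [x = b] (mod p ^ i) \<longleftrightarrow>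
       L b i \<le> lo x \<and> lo x \<le> H b i \<and> (lo x = L b i \<longrightarrow> i \<le> \<alpha> x)"
    and P_hi: "\<And>b i x. b \<in> M \<Longrightarrow> i \<le> N \<Longrightarrow> [x = b] (mod p ^ i) \<longleftrightarrow>
       L b i \<le> hi x \<and> hi x \<le> H b i \<and> (hi x = H b i \<longrightarrow> i \<le> \<alpha> x)"
    by (rule class_coordinates[OF fin ne, of N p]) (unfold n_def, blast)
  obtain lo' hi' \<beta> L' H' where
    lohi': "\<And>x. lo' x < n" "\<And>x. hi' x < n" "\<And>x. \<beta> x \<le> N"
    and H': "\<And>b i. b \<in> M \<Longrightarrow> i \<le> N \<Longrightarrow> H' b i < n"
    and card: "\<And>b i. b \<in> M \<Longrightarrow> i \<le> N \<Longrightarrow> Suc (H' b i) = L' b i + card (class_of M (q ^ i) b)"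
    and Q_lo: "\<And>b i x. b \<in> M \<Longrightarrow> i \<le> N \<Longrightarrow> [x = b] (mod q ^ i) \<longleftrightarrow>
       L' b i \<le> lo' x \<and> lo' x \<le> H' b i \<and> (lo' x = L' b i \<longrightarrow> i \<le> \<beta> x)"
    and Q_hi: "\<And>b i x. b \<in> M \<Longrightarrow> i \<le> N \<Longrightarrow> [x = b] (mod q ^ i) \<longleftrightarrow>
       L' b i \<le> hi' x \<and> hi' x \<le> H' b i \<and> (hi' x = H' b i \<longrightarrow> i \<le> \<beta> x)"
    by (rule class_coordinates[OF fin ne, of N q]) (unfold n_def, blast)
  define K where "K = int N + 1"
  \<comment> \<open>The values are 1, 2, 4, 5, 7, 8, ..., leaving the multiples of 3 to the q-order;
    \<open>3 * k x\<close> is the multiple of 3 next to the position of \<open>lo x\<close> or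
    \<open>hi x\<close>.\<close>
  define pos where "pos s = int (s + s div 2 + 1)" for s
  define k where "k x = (if even (lo x) then int (lo x div 2) else int ((hi x + 1) div 2))" for x
  define c where "c x = (if even (lo x) then int (hi' x) else int (lo' x)) - k x" for x
  \<comment> \<open>In both cases \<open>y\<close> stands directly to the left of \<open>z\<close>,
    one at a p-position and one at a q-position. A bound of one kind never falls on a position of
    the other kind, so it cannot separate the two neighbors, and either of them may be
    tested.\<close>
  define y where "y x = (if even (lo x) then 3 * k x * K - \<beta> x else pos (hi x) * K - \<alpha> x)" for x
  define z where "z x = (if even (lo x) then pos (lo x) * K + \<alpha> x else 3 * k x * K + \<beta> x)" for x
  have K: "0 < K" "int i < K" if "i \<le> N" for i using that by (auto simp: K_def)
  have k_even: "pos (lo x) = 3 * k x + 1" if "even (lo x)" for x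
    using that by (auto simp: pos_def k_def elim!: evenE)
  have k_odd: "pos (hi x) = 3 * k x - 1" if "odd (lo x)" for x
    using that lohi(3)[OF that] by (auto simp: pos_def k_def elim!: oddE)
  have pos_less: "pos s < pos s'" if "s < s'" for s s'
    using that div_le_mono[of s s' 2] unfolding pos_def by linarith
  have pos_mono: "pos s \<le> pos s' \<longleftrightarrow> s \<le> s'" "pos s < pos s' \<longleftrightarrow> s < s'" "pos s = pos s' \<longleftrightarrow> s = s'" for s s'
    using pos_less[of s s'] pos_less[of s' s] by (cases rule: linorder_cases[of s s']; force)+
  have pos_mod: "pos s \<noteq> 3 * i" for s i
  proof (cases "even s")
    case True
    then obtain a where "s = 2 * a" by (elim evenE)
    then have "pos s = 3 * int a + 1" by (simp add: pos_def)
    then show ?thesis by presburger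
  next
    case False
    then obtain a where "s = 2 * a + 1" by (elim oddE)
    then have "pos s = 3 * int a + 2" by (simp add: pos_def)
    then show ?thesis by presburger
  qed
  have k_bounds: "0 \<le> k x" "k x \<le> int (n div 2)" for x
    using lohi(1)[of x] lohi(2)[of x] unfolding k_def by (auto simp del: of_nat_div)
  define g where "g x = c x mod int n" for x
  have n: "0 < n" using fin ne by (simp add: n_def card_gt_0_iff)
  have P: "[x = b] (mod p ^ i) \<longleftrightarrow> y x \<le> pos (H b i) * K - i \<and> pos (L b i) * K + i \<le> z x"
    if b: "b \<in> M" "i \<le> N" for b i x
  proof (cases "even (lo x)")
    case True
    have "y x \<le> pos (H b i) * K - i \<longleftrightarrow> 3 * k x < pos (H b i)"
      using mult_diff_le_iff[of "\<beta> x" K i "3 * k x" "pos (H b i)"] True lohi' K b(2) pos_mod[of "H b i" "k x"]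
      by (auto simp: y_def)
    also have "\<dots> \<longleftrightarrow> pos (lo x) \<le> pos (H b i)" using k_even[OF True] by linarith
    finally have 1: "y x \<le> pos (H b i) * K - i \<longleftrightarrow> lo x \<le> H b i" using pos_mono by simp
    have 2: "pos (L b i) * K + i \<le> z x \<longleftrightarrow> L b i < lo x \<or> L b i = lo x \<and> i \<le> \<alpha> x"
      using mult_add_le_iff[of i K "\<alpha> x" "pos (L b i)" "pos (lo x)"] True lohi K b(2) pos_mono
      by (auto simp: z_def)
    show ?thesis unfolding 1 2 P_lo[OF b] by auto
  next
    case False
    have "pos (L b i) * K + i \<le> z x \<longleftrightarrow> pos (L b i) < 3 * k x"
      using mult_add_le_iff[of i K "\<beta> x" "pos (L b i)" "3 * k x"] False lohi' K b(2) pos_mod[of "L b i" "k x"]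
      by (auto simp: z_def)
    also have "\<dots> \<longleftrightarrow> pos (L b i) \<le> pos (hi x)" using k_odd[OF False] by linarith
    finally have 1: "pos (L b i) * K + i \<le> z x \<longleftrightarrow> L b i \<le> hi x" using pos_mono by simp
    have 2: "y x \<le> pos (H b i) * K - i \<longleftrightarrow> hi x < H b i \<or> hi x = H b i \<and> i \<le> \<alpha> x"
      using mult_diff_le_iff[of "\<alpha> x" K i "pos (hi x)" "pos (H b i)"] False lohi K b(2) pos_mono
      by (auto simp: y_def)
    show ?thesis unfolding 1 2 P_hi[OF b] by auto
  qed
  have Q_c: "c x \<in> {int (L' b j) - int (n div 2)..int (H' b j)}"
    if "b \<in> M" "j \<le> N" "[x = b] (mod q ^ j)" for b j x
    using Q_lo[of b j x] Q_hi[of b j x] that k_bounds[of x] by (auto simp: c_def)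
  have Q: "[x = b] (mod q ^ j) \<and> c x = i \<longleftrightarrow> g x = i mod int n \<and>
      y x \<le> 3 * (int (H' b j) - i) * K - j \<and> 3 * (int (L' b j) - i) * K + j \<le> z x"
    if b: "b \<in> M" "j \<le> N" for b j x i
  proof (cases "g x = i mod int n")
    case True
    define r where "r = c x + k x"
    have r: "r = (if even (lo x) then int (hi' x) else int (lo' x))" by (simp add: r_def c_def)
    have "int n dvd c x - i" using True by (simp add: g_def mod_eq_dvd_iff)
    then obtain e where e: "c x = i + int n * e" by (auto simp: dvd_def algebra_simps)
    \<comment> \<open>The group determines the shift only modulo \<open>n\<close>. But
      \<open>c x + k x\<close> and \<open>i + k x\<close> are congruent modulo \<open>n\<close> and
      both are ranks below \<open>n\<close>, hence equal.\<close>
    have same: "c x = i" if "int (L' b j) - i \<le> k x" "k x \<le> int (H' b j) - i"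
    proof -
      have "int n * e \<le> r" "r - int n * e < int n"
        using that e H'[OF b] by (auto simp: r_def)
      moreover have "0 \<le> r" "r < int n" using r lohi' by auto
      ultimately have "int n * e < int n * 1" "int n * (- 1) < int n * e" by linarith+
      then have "e < 1" "- 1 < e" using n by (simp_all only: mult_less_cancel_left_pos of_nat_0_less_iff)
      then have "e = 0" by linarith
      then show ?thesis using e by simp
    qed
    show ?thesis
    proof (cases "even (lo x)")
      case even: True
      have "y x \<le> 3 * (int (H' b j) - i) * K - j \<longleftrightarrow>
          k x < int (H' b j) - i \<or> k x = int (H' b j) - i \<and> j \<le> \<beta> x"
        using mult_diff_le_iff[of "\<beta> x" K j "3 * k x" "3 * (int (H' b j) - i)"] even lohi' K b(2)
        by (auto simp: y_def)
      moreover have "3 * (int (L' b j) - i) * K + j \<le> z x \<longleftrightarrow> int (L' b j) - i \<le> k x"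
        using mult_add_le_iff[of j K "\<alpha> x" "3 * (int (L' b j) - i)" "pos (lo x)"] even lohi K b(2)
          k_even[OF even] by (auto simp: z_def)
      ultimately show ?thesis
        using same True even r unfolding Q_hi[OF b] r_def by auto
    next
      case odd: False
      have "y x \<le> 3 * (int (H' b j) - i) * K - j \<longleftrightarrow> k x \<le> int (H' b j) - i"
        using mult_diff_le_iff[of "\<alpha> x" K j "pos (hi x)" "3 * (int (H' b j) - i)"] odd lohi K b(2)
          k_odd[OF odd] by (auto simp: y_def)
      moreover have "3 * (int (L' b j) - i) * K + j \<le> z x \<longleftrightarrow>
          int (L' b j) - i < k x \<or> int (L' b j) - i = k x \<and> j \<le> \<beta> x"
        using mult_add_le_iff[of j K "\<beta> x" "3 * (int (L' b j) - i)" "3 * k x"] odd lohi' K b(2)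
        by (auto simp: z_def)
      ultimately show ?thesis
        using same True odd r unfolding Q_lo[OF b] r_def by auto
    qed
  qed (auto simp: g_def)
  have size: "card {int (L' b j) - int (n div 2)..int (H' b j)} \<le> n" if "b \<in> M" "0 < j" "j \<le> N" for b j
  proof -
    have "class_of M (q ^ j) b \<subseteq> class_of M q b"
      using cong_pow_mono[of _ b q j 1] that(2) by (auto simp: class_of_def)
    moreover have "finite (class_of M q b)" using fin by (simp add: class_of_def)
    ultimately have "card (class_of M (q ^ j) b) \<le> (n + 1) div 2"
      using card_mono small[OF that(1)] le_trans by blast
    then show ?thesis using card[OF that(1,3)] by auto
  qed
  show thesis
  proof (rule that[of g "\<lambda>x. real_of_int (y x)" "\<lambda>x. real_of_int (- z x)" c])
    show "g x \<in> {0..<int n}" for x using n by (simp add: g_def)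
    show "\<exists>y0 z0. \<forall>x. [x = b] (mod p ^ i) \<longleftrightarrow> real_of_int (y x) \<le> y0 \<and> real_of_int (- z x) \<le> z0"
      if "b \<in> M" "i \<le> N" for b i
      by (intro exI[of _ "real_of_int (pos (H b i) * K - i)"] exI[of _ "real_of_int (- (pos (L b i) * K + i))"])
         (simp only: P[OF that] of_int_le_iff neg_le_iff_le simp_thms)
    show "\<exists>I. finite I \<and> card I \<le> n \<and>
       (\<forall>x. [x = b] (mod q ^ j) \<longrightarrow> c x \<in> I) \<and>
       (\<forall>i\<in>I. \<exists>\<gamma> y0 z0. \<forall>x. [x = b] (mod q ^ j) \<and> c x = i \<longleftrightarrow>
          g x = \<gamma> \<and> real_of_int (y x) \<le> y0 \<and> real_of_int (- z x) \<le> z0)"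
      if b: "b \<in> M" "0 < j" "j \<le> N" for b j
    proof (intro exI[of _ "{int (L' b j) - int (n div 2)..int (H' b j)}"] conjI allI impI ballI)
      fix i
      show "\<exists>\<gamma> y0 z0. \<forall>x. [x = b] (mod q ^ j) \<and> c x = i \<longleftrightarrow>
          g x = \<gamma> \<and> real_of_int (y x) \<le> y0 \<and> real_of_int (- z x) \<le> z0"
        by (intro exI[of _ "i mod int n"] exI[of _ "real_of_int (3 * (int (H' b j) - i) * K - j)"]
             exI[of _ "real_of_int (- (3 * (int (L' b j) - i) * K + j))"])
           (simp only: Q[OF b(1,3)] of_int_le_iff neg_le_iff_le simp_thms)
    qed (use Q_c[OF b(1,3)] size[OF b] in auto)
  qed
qed

section \<open>Upper bounds\<close>

lemma AP_edge_eq: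
  fixes a b d m :: nat
  assumes "a = b + m * d"
  shows "{a + n * d | n. True} \<inter> S = {x\<in>S. a \<le> x \<and> [x = b] (mod d)}"
proof -
  have "(\<exists>n. x = a + n * d) \<longleftrightarrow> a \<le> x \<and> [x = b] (mod d)" for x
  proof
    assume "a \<le> x \<and> [x = b] (mod d)"
    moreover have "[b = a] (mod d)" using assms by (simp add: cong_def)
    ultimately have "d dvd x - a" "a \<le> x" using cong_altdef_nat cong_trans by blast+
    then obtain n where "x - a = d * n" by (elim dvdE)
    then show "\<exists>n. x = a + n * d" using \<open>a \<le> x\<close> by (intro exI[of _ n]) (simp add: mult.commute)
  next
    assume "\<exists>n. x = a + n * d"
    then show "a \<le> x \<and> [x = b] (mod d)" using assms by (auto simp: cong_def)
  qed
  then show ?thesis by blast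
qed

text \<open>Numbers below \<open>t ^ N\<close> that are congruent modulo \<open>t ^ N\<close> are
  equal, so exponents can be cut off at \<open>N\<close> and finitely many levels are
  enough.\<close>

lemma cong_pow_min:
  fixes x b t :: nat
  assumes "x < t ^ N" "b < t ^ N"
  shows "[x = b] (mod t ^ i) \<longleftrightarrow> [x = b] (mod t ^ min i N)"
proof
  assume "[x = b] (mod t ^ min i N)"
  then show "[x = b] (mod t ^ i)"
    using assms by (cases "i \<le> N") (auto simp: cong_def min_def)
qed (auto intro: cong_pow_mono)

lemma pow_exceeds_finite:
  fixes A :: "nat set"
  assumes "finite A"
  obtains N where "\<And>x t. x \<in> A \<Longrightarrow> 2 \<le> t \<Longrightarrow> x < t ^ N"
proof -
  obtain N where "\<And>x. x \<in> A \<Longrightarrow> x < N"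
    using assms by (metis finite_nat_set_iff_bounded)
  then have "x < t ^ N" if "x \<in> A" "2 \<le> t" for x t :: nat
    using that less_exp[of N] power_mono[of 2 t N] by (meson less_trans less_le_trans zero_le)
  then show thesis using that by blast
qed

lemma coprime_cong_iff:
  fixes x b :: nat
  assumes "coprime p q"
  shows "[x = b] (mod p ^ i * q ^ j) \<longleftrightarrow> [x = b] (mod p ^ i) \<and> [x = b] (mod q ^ j)"
proof
  assume *: "[x = b] (mod p ^ i * q ^ j)"
  then have "[x = b] (mod q ^ j * p ^ i)" by (simp only: mult.commute)
  with * show "[x = b] (mod p ^ i) \<and> [x = b] (mod q ^ j)" using cong_modulus_mult_nat by blast
next
  have "coprime (p ^ i) (q ^ j)" using assms by simp
  then show "[x = b] (mod p ^ i) \<and> [x = b] (mod q ^ j) \<Longrightarrow> [x = b] (mod p ^ i * q ^ j)"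
    using coprime_cong_mult_nat by blast
qed

lemma threshold_AP_inf_powers:
  assumes "threshold k T3 m" "0 < m" "2 \<le> t"
  shows "threshold k (AP_inf {t ^ i | i. True} UNIV) m"
  unfolding threshold_def
proof
  fix H assume "H \<in> AP_inf {t ^ i | i. True} UNIV"
  then obtain S E where H: "H = (S, E)" "finite S"
    and E: "\<And>e. e \<in> E \<Longrightarrow> \<exists>i a. e = {a + n * t ^ i | n. True} \<inter> S"
    unfolding AP_inf_def by fast
  obtain N where N: "\<And>x. x \<in> S \<Longrightarrow> x < t ^ N"
    using pow_exceeds_finite[OF H(2)] assms(3) by metis
  obtain \<sigma> :: "nat \<Rightarrow> nat" where "bij_betw \<sigma> S {..<card S}"
    and \<sigma>: "\<And>i b. i \<le> N \<Longrightarrow> b \<in> S \<Longrightarrow> \<exists>l h. l \<le> h \<and> h < card S \<and> (odd l \<longrightarrow> odd h) \<and>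
       class_of S (t ^ i) b = {x\<in>S. l \<le> \<sigma> x \<and> \<sigma> x \<le> h}"
    using class_interval_order[OF H(2)] by blast
  have "\<exists>I :: int set. \<exists>\<O>. finite I \<and> card I \<le> 1 \<and> e = (\<Union>i\<in>I. \<O> i) \<and>
      (\<forall>i\<in>I. \<exists>\<gamma> x0 y0 z0. \<O> i = {v\<in>S. 0 = (\<gamma>::int) \<and> x0 \<le> real v \<and> real (\<sigma> v) \<le> y0 \<and> - real (\<sigma> v) \<le> z0})"
    if e: "e \<in> E" for e
  proof (cases "e = {}")
    case True
    then show ?thesis by (intro exI[of _ "{}"]) auto
  next
    case False
    obtain i a where ia: "e = {a + n * t ^ i | n. True} \<inter> S" using E[OF e] by blast
    then have e_eq: "e = {x\<in>S. a \<le> x \<and> [x = a] (mod t ^ i)}" using AP_edge_eq[of a a 0] by simp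
    \<comment> \<open>The order ranks only the elements of \<open>S\<close>, so the residue has to
      be represented by a vertex of the edge.\<close>
    then obtain b where b: "b \<in> S" "[b = a] (mod t ^ i)" using False by auto
    obtain l h where lh: "class_of S (t ^ min i N) b = {x\<in>S. l \<le> \<sigma> x \<and> \<sigma> x \<le> h}"
      using \<sigma>[OF min.cobounded2 b(1)] by blast
    have "e = {x\<in>S. a \<le> x \<and> [x = b] (mod t ^ i)}"
      unfolding e_eq using b(2) by (auto intro: cong_trans cong_sym)
    also have "\<dots> = {x\<in>S. a \<le> x} \<inter> class_of S (t ^ min i N) b"
      using cong_pow_min[OF N N[OF b(1)], of _ i] by (auto simp: class_of_def)
    also have "\<dots> = {v\<in>S. 0 = (0::int) \<and> real a \<le> real v \<and> real (\<sigma> v) \<le> real h \<and> - real (\<sigma> v) \<le> - real l}"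
      unfolding lh by auto
    finally have "\<exists>\<gamma> x0 y0 z0. e =
        {v\<in>S. 0 = (\<gamma>::int) \<and> x0 \<le> real v \<and> real (\<sigma> v) \<le> y0 \<and> - real (\<sigma> v) \<le> z0}"
      by blast
    then show ?thesis by (intro exI[of _ "{0}"] exI[of _ "\<lambda>_. e"]) simp
  qed
  from polychromatic_by_octants[OF assms(1,2) H(2) this]
  show "\<exists>c. polychromatic k (restrict_edges H m) c"
    using assms(2) H(1) by simp
qed

lemma threshold_AP_inf_coprime:
  assumes threshold: "threshold k T3 m" "0 < m" and pq: "1 < p" "1 < q" "coprime p q"
    and M: "finite M" "M \<noteq> {}"
    and small: "\<And>b. b \<in> M \<Longrightarrow> card (class_of M q b) \<le> (card M + 1) div 2"
  shows "threshold k (AP_inf {p ^ i * q ^ j | i j. True} M) (card M * (m - 1) + 1)"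
  unfolding threshold_def
proof
  fix \<H> assume "\<H> \<in> AP_inf {p ^ i * q ^ j | i j. True} M"
  then obtain S E where \<H>: "\<H> = (S, E)" "finite S"
    and E: "\<And>e. e \<in> E \<Longrightarrow> \<exists>i j m' b a. b \<in> M \<and> a = b + m' * (p ^ i * q ^ j) \<and>
       e = {a + n * (p ^ i * q ^ j) | n. True} \<inter> S"
    unfolding AP_inf_def by fast
  obtain N where "\<And>x t. x \<in> S \<union> M \<Longrightarrow> 2 \<le> t \<Longrightarrow> x < t ^ N"
    using pow_exceeds_finite[of "S \<union> M"] \<H>(2) M(1) by blast
  then have N: "x < p ^ N" "x < q ^ N" if "x \<in> S \<union> M" for x
    using that pq(1,2) by simp_all
  show "\<exists>c. polychromatic k (restrict_edges \<H> (card M * (m - 1) + 1)) c"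
  proof (rule octant_coordinates[OF M small, of N p])
    fix g c :: "nat \<Rightarrow> int" and y z :: "nat \<Rightarrow> real"
    assume
      g: "\<And>x. g x \<in> {0..<int (card M)}" and
      P: "\<And>b i. b \<in> M \<Longrightarrow> i \<le> N \<Longrightarrow> \<exists>y0 z0. \<forall>x. [x = b] (mod p ^ i) \<longleftrightarrow> y x \<le> y0 \<and> z x \<le> z0" and
      Q: "\<And>b j. b \<in> M \<Longrightarrow> 0 < j \<Longrightarrow> j \<le> N \<Longrightarrow> \<exists>I. finite I \<and> card I \<le> card M \<and>
         (\<forall>x. [x = b] (mod q ^ j) \<longrightarrow> c x \<in> I) \<and>
         (\<forall>i\<in>I. \<exists>\<gamma> y0 z0. \<forall>x. [x = b] (mod q ^ j) \<and> c x = i \<longleftrightarrow>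
            g x = \<gamma> \<and> y x \<le> y0 \<and> z x \<le> z0)"
    have "\<exists>I :: int set. \<exists>\<O>. finite I \<and> card I \<le> card M \<and> e = (\<Union>i\<in>I. \<O> i) \<and>
        (\<forall>i\<in>I. \<exists>\<gamma> x0 y0 z0. \<O> i = {v\<in>S. g v = \<gamma> \<and> x0 \<le> real v \<and> y v \<le> y0 \<and> z v \<le> z0})"
      if e: "e \<in> E" for e
    proof -
      obtain i0 j0 m' b a where b: "b \<in> M" and a: "a = b + m' * (p ^ i0 * q ^ j0)"
        and e_eq: "e = {a + n * (p ^ i0 * q ^ j0) | n. True} \<inter> S"
        using E[OF e] by blast
      define i where "i = min i0 N"
      define j where "j = min j0 N"
      have ij: "i \<le> N" "j \<le> N" by (auto simp: i_def j_def)
      have "[x = b] (mod p ^ i0 * q ^ j0) \<longleftrightarrow> [x = b] (mod p ^ i) \<and> [x = b] (mod q ^ j)" if "x \<in> S" for x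
        unfolding coprime_cong_iff[OF pq(3)] i_def j_def
        using cong_pow_min[OF N(1) N(1), of x b i0] cong_pow_min[OF N(2) N(2), of x b j0] that b
        by blast
      then have e_eq: "e = {x\<in>S. a \<le> x \<and> [x = b] (mod p ^ i) \<and> [x = b] (mod q ^ j)}"
        unfolding e_eq AP_edge_eq[OF a] by blast
      obtain y0 z0 where yz: "\<And>x. [x = b] (mod p ^ i) \<longleftrightarrow> y x \<le> y0 \<and> z x \<le> z0"
        using P[OF b ij(1)] by blast
      show ?thesis
      proof (cases "j = 0")
        \<comment> \<open>With no condition modulo \<open>q\<close>, the p-bounds cut one octant out
          of each of the \<open>card M\<close> groups.\<close>
        case True
        show ?thesis
        proof (intro exI[of _ "{0..<int (card M)}"] conjI ballI
            exI[of _ "\<lambda>\<gamma>. {v\<in>S. g v = \<gamma> \<and> real a \<le> real v \<and> y v \<le> y0 \<and> z v \<le> z0}"])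
          show "e = (\<Union>\<gamma>\<in>{0..<int (card M)}. {v\<in>S. g v = \<gamma> \<and> real a \<le> real v \<and> y v \<le> y0 \<and> z v \<le> z0})"
            using g unfolding e_eq yz True by auto
        qed (simp, simp, blast)
      next
        case False
        then have "0 < j" by simp
        from Q[OF b this ij(2)] obtain I where I: "finite I" "card I \<le> card M"
            "\<forall>x. [x = b] (mod q ^ j) \<longrightarrow> c x \<in> I"
          and oct: "\<forall>i\<in>I. \<exists>\<gamma> y0 z0. \<forall>x. [x = b] (mod q ^ j) \<and> c x = i \<longleftrightarrow>
            g x = \<gamma> \<and> y x \<le> y0 \<and> z x \<le> z0"
          by (elim exE conjE) (rule that)
        show ?thesis
        proof (intro exI[of _ I] conjI ballI exI[of _ "\<lambda>i. {v\<in>e. c v = i}"] I(1,2))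
          show "e = (\<Union>i\<in>I. {v\<in>e. c v = i})" using I(3) by (auto simp: e_eq)
          fix i assume "i \<in> I"
          with oct obtain \<gamma> y1 z1 where oct': "\<forall>x. [x = b] (mod q ^ j) \<and> c x = i \<longleftrightarrow>
            g x = \<gamma> \<and> y x \<le> y1 \<and> z x \<le> z1"
            by (elim ballE exE) (rule that, assumption, blast)
          have "{v\<in>e. c v = i} = {v\<in>S. a \<le> v \<and> (y v \<le> y0 \<and> z v \<le> z0) \<and> g v = \<gamma> \<and> y v \<le> y1 \<and> z v \<le> z1}"
            unfolding e_eq oct'[rule_format, symmetric] yz[symmetric] by auto
          \<comment> \<open>The p-bounds and q-bounds act on the same two coordinates, so they merge
            into a single octant.\<close>
          also have "\<dots> = {v\<in>S. g v = \<gamma> \<and> real a \<le> real v \<and> y v \<le> min y0 y1 \<and> z v \<le> min z0 z1}"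
            by auto
          finally show "\<exists>\<gamma> x0 y0 z0. {v\<in>e. c v = i} =
              {v\<in>S. g v = \<gamma> \<and> x0 \<le> real v \<and> y v \<le> y0 \<and> z v \<le> z0}"
            by blast
        qed
      qed
    qed
    from polychromatic_by_octants[OF threshold \<H>(2) this]
    show "\<exists>c. polychromatic k (restrict_edges \<H> (card M * (m - 1) + 1)) c"
      using \<H>(1) by simp
  qed
qed

text \<open>A p-class and a q-class of \<open>M\<close> share at most one element, so their sizes
  add up to at most \<open>card M + 1\<close>. If some q-class is too large, all p-classes are small
  enough, and the two bases change roles.\<close>

lemma threshold_AP_inf_incongruent:
  assumes threshold: "threshold k T3 m" "0 < m" and pq: "1 < p" "1 < q" "coprime p q"
    and M: "finite M" "M \<noteq> {}" and inj: "\<And>x y. x \<in> M \<Longrightarrow> y \<in> M \<Longrightarrow> [x = y] (mod p * q) \<Longrightarrow> x = y"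
  shows "threshold k (AP_inf {p ^ i * q ^ j | i j. True} M) (card M * (m - 1) + 1)"
proof (cases "\<forall>b\<in>M. card (class_of M q b) \<le> (card M + 1) div 2")
  case True
  then show ?thesis using threshold_AP_inf_coprime[OF threshold pq M] by blast
next
  case False
  then obtain b where b: "b \<in> M" "(card M + 1) div 2 < card (class_of M q b)" by auto
  have "card (class_of M p b') \<le> (card M + 1) div 2" if "b' \<in> M" for b'
  proof -
    let ?B = "class_of M q b" and ?A = "class_of M p b'"
    have fin: "finite ?A" "finite ?B" using M(1) by (auto simp: class_of_def)
    have "x = y" if "x \<in> ?A \<inter> ?B" "y \<in> ?A \<inter> ?B" for x y
    proof -
      have "[x = y] (mod p)" "[x = y] (mod q)"
        using that by (auto simp: class_of_def intro: cong_trans cong_sym)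
      then have "[x = y] (mod p * q)" using coprime_cong_mult_nat pq(3) by blast
      then show ?thesis using inj that by (auto simp: class_of_def)
    qed
    then have "card (?A \<inter> ?B) \<le> 1" using fin by (auto simp: card_le_Suc0_iff_eq)
    moreover have "card (?A \<union> ?B) \<le> card M"
      using M(1) by (intro card_mono) (auto simp: class_of_def)
    ultimately show ?thesis using card_Un_Int[OF fin] b(2) by linarith
  qed
  then have "threshold k (AP_inf {q ^ i * p ^ j | i j. True} M) (card M * (m - 1) + 1)"
    using threshold_AP_inf_coprime[OF threshold pq(2,1) _ M] pq(3) by (simp add: coprime_commute)
  moreover have "{q ^ i * p ^ j | i j. True} = {p ^ i * q ^ j | i j. True}"
    by (auto simp: mult.commute)
  ultimately show ?thesis by simp
qed

section \<open>Embedding hypergraphs into progressions\<close>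

text \<open>\<open>W v\<close> carries the prescribed exponents, and a factor congruent to 1 modulo
  \<open>P\<close> does not disturb them when \<open>P\<close> is the product of the bases. Vertices
  are added by increasing key, with \<open>c\<close> the sum of all previous values, so each new
  value exceeds them all, also among equal keys.\<close>

lemma increasing_multiples:
  fixes \<kappa> :: "'a \<Rightarrow> 'b::linorder" and W :: "'a \<Rightarrow> nat"
  assumes "finite V" and W: "\<And>v. 0 < W v" and "0 < P"
  shows "\<exists>f. inj_on f V \<and> (\<forall>u\<in>V. \<forall>v\<in>V. \<kappa> u < \<kappa> v \<longrightarrow> f u < f v) \<and>
    (\<forall>v\<in>V. \<exists>c. f v = W v * (1 + P * c))"
  using assms(1)
proof (induction V rule: finite_ranking_induct[where f = \<kappa>])
  case (insert x V)
  then obtain f where f: "inj_on f V" "\<forall>u\<in>V. \<forall>v\<in>V. \<kappa> u < \<kappa> v \<longrightarrow> f u < f v"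
    "\<forall>v\<in>V. \<exists>c. f v = W v * (1 + P * c)" by blast
  show ?case
  proof (cases "x \<in> V")
    case True
    then show ?thesis using f by (auto simp: insert_absorb)
  next
    case False
    define f' where "f' = f(x := W x * (1 + P * sum f V))"
    have less: "f' v < f' x" "f' v = f v" if "v \<in> V" for v
    proof -
      have "v \<noteq> x" using False that by blast
      then show "f' v = f v" by (simp add: f'_def)
      have "f v \<le> sum f V" using insert.hyps(1) that by (simp add: member_le_sum)
      also have "\<dots> \<le> P * sum f V" using \<open>0 < P\<close> by simp
      also have "\<dots> < 1 + P * sum f V" by simp
      also have "\<dots> \<le> W x * (1 + P * sum f V)" using W[of x] by (cases "W x") auto
      finally show "f' v < f' x" using \<open>v \<noteq> x\<close> by (simp add: f'_def)
    qed
    have "inj_on f' V" using f(1) less(2) by (simp cong: inj_on_cong)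
    moreover have "f' x \<notin> f' ` (V - {x})" using less(1) by force
    ultimately have "inj_on f' (insert x V)" by simp
    moreover have "f' u < f' v" if "u \<in> insert x V" "v \<in> insert x V" "\<kappa> u < \<kappa> v" for u v
    proof -
      have "u \<noteq> x" using that insert.hyps(2) by (auto simp: leD)
      then show ?thesis using that f(2) less by auto
    qed
    moreover have "\<exists>c. f' v = W v * (1 + P * c)" if "v \<in> insert x V" for v
      using that f(3) less(2) by (cases "v = x") (auto simp: f'_def)
    ultimately show ?thesis by blast
  qed
qed auto

text \<open>A nonempty edge is cut out by its least vertex, which is itself a multiple of the difference.\<close>

lemma polychromatic_if_embeds_into_AP:
  fixes \<kappa> :: "'a \<Rightarrow> 'b::linorder"
  assumes threshold: "threshold k (AP_inf D {0}) m" and "0 < m" and fin: "finite V" and inj: "inj_on f V"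
    and mono: "\<And>u v. u \<in> V \<Longrightarrow> v \<in> V \<Longrightarrow> \<kappa> u < \<kappa> v \<Longrightarrow> f u < f v"
    and edges: "\<And>e. e \<in> E \<Longrightarrow> e \<noteq> {} \<Longrightarrow> \<exists>d\<in>D. \<exists>\<kappa>0. e = {v\<in>V. \<kappa>0 \<le> \<kappa> v \<and> d dvd f v}"
  shows "\<exists>c. polychromatic k (restrict_edges (V, E) m) c"
proof -
  \<comment> \<open>An empty edge has no least vertex; it may be dropped because it has fewer than
    \<open>m\<close> vertices.\<close>
  let ?H = "(f ` V, (`) f ` (E - {{}}))"
  have "\<exists>d\<in>D. \<exists>a. (\<exists>j. \<exists>b\<in>{0}. a = b + j * d) \<and> f ` e = {a + n * d | n. True} \<inter> f ` V"
    if e: "e \<in> E" "e \<noteq> {}" for e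
  proof -
    obtain d \<kappa>0 where d: "d \<in> D" and e_eq: "e = {v\<in>V. \<kappa>0 \<le> \<kappa> v \<and> d dvd f v}"
      using edges[OF e] by blast
    define a where "a = Min (f ` e)"
    have fin_e: "finite (f ` e)" using fin by (simp add: e_eq)
    have "a \<in> f ` e" unfolding a_def using fin_e e(2) by (intro Min_in) auto
    then obtain v0 where v0: "v0 \<in> e" "a = f v0" by blast
    then have "d dvd a" by (simp add: e_eq)
    then obtain j where j: "a = 0 + j * d" by (metis add_0 dvdE mult.commute)
    have "v \<in> e \<longleftrightarrow> a \<le> f v \<and> d dvd f v" if "v \<in> V" for v
    proof
      assume "v \<in> e"
      then show "a \<le> f v \<and> d dvd f v" using fin_e by (auto simp: a_def e_eq)
    next
      assume "a \<le> f v \<and> d dvd f v"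
      moreover have "\<not> \<kappa> v < \<kappa> v0" using mono[OF that, of v0] v0 calculation by (auto simp: e_eq)
      ultimately show "v \<in> e" using v0 that by (auto simp: e_eq)
    qed
    then have "f ` e = {x \<in> f ` V. a \<le> x \<and> d dvd x}" using e_eq by blast
    then have "f ` e = {a + n * d | n. True} \<inter> f ` V"
      using AP_edge_eq[OF j, of "f ` V"] by (simp only: cong_0_iff)
    moreover have "\<exists>j. \<exists>b\<in>{0}. a = b + j * d" using j by blast
    ultimately show ?thesis using d by blast
  qed
  then have "?H \<in> AP_inf D {0}"
    using fin by (auto simp: AP_inf_def)
  then obtain c where c: "polychromatic k (restrict_edges ?H m) c"
    using threshold by (auto simp: threshold_def)
  have "\<exists>v\<in>e. c (f v) = i" if e: "e \<in> E" "m \<le> card e" and i: "i < k" for e i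
  proof -
    have "e \<noteq> {}" using e(2) \<open>0 < m\<close> by auto
    then have "e \<subseteq> V" using edges[OF e(1)] by auto
    then have "card (f ` e) = card e" using inj by (intro card_image) (rule inj_on_subset)
    then have "f ` e \<in> snd (restrict_edges ?H m)"
      using e \<open>e \<noteq> {}\<close> by (auto simp: restrict_edges_def)
    then have "\<exists>x\<in>f ` e. c x = i" using c i unfolding polychromatic_def by blast
    then show ?thesis by blast
  qed
  then show ?thesis
    using c by (intro exI[of _ "c \<circ> f"]) (simp add: polychromatic_def restrict_edges_def)
qed

lemma power_dvd_power_mult_iff:
  fixes p r :: nat
  assumes "1 < p" "coprime p r"
  shows "p ^ i dvd p ^ j * r \<longleftrightarrow> i \<le> j"
proof
  assume "p ^ i dvd p ^ j * r"
  moreover have "coprime (p ^ i) r" using assms(2) by simp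
  ultimately have "p ^ i dvd p ^ j" by (simp add: coprime_dvd_mult_left_iff)
  then show "i \<le> j" using assms(1) power_dvd_imp_le by blast
qed (simp add: le_imp_power_dvd)

lemma coprime_Suc_mult: "coprime p (1 + p * c)" for p c :: nat
proof (rule coprimeI)
  fix d assume "d dvd p" "d dvd 1 + p * c"
  then show "is_unit d" using dvd_add_left_iff[of d "p * c" 1] by simp
qed

text \<open>Taking the number of vertices strictly above \<open>v\<close> as exponent turns an upper
  bound on a coordinate into divisibility by a power.\<close>

lemma threshold_card_iff:
  fixes y :: "'a \<Rightarrow> real"
  assumes "finite V" "v \<in> V"
  shows "card {u\<in>V. y0 < y u} \<le> card {u\<in>V. y v < y u} \<longleftrightarrow> y v \<le> y0"
proof
  assume *: "card {u\<in>V. y0 < y u} \<le> card {u\<in>V. y v < y u}"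
  show "y v \<le> y0"
  proof (rule ccontr)
    assume "\<not> y v \<le> y0"
    then have "y0 < y v" by simp
    then have "{u\<in>V. y v < y u} \<subseteq> {u\<in>V. y0 < y u}" by (auto intro: less_trans)
    moreover have "v \<in> {u\<in>V. y0 < y u}" "v \<notin> {u\<in>V. y v < y u}"
      using \<open>y0 < y v\<close> assms(2) by simp_all
    ultimately have "{u\<in>V. y v < y u} \<subset> {u\<in>V. y0 < y u}" by blast
    then have "card {u\<in>V. y v < y u} < card {u\<in>V. y0 < y u}"
      using assms(1) by (intro psubset_card_mono) auto
    then show False using * by simp
  qed
qed (use assms(1) in \<open>auto intro!: card_mono\<close>)

lemma threshold_T3_if_threshold_AP:
  assumes threshold: "threshold k (AP_inf {p ^ i * q ^ j | i j. True} {0}) m" and "0 < m"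
    and pq: "1 < p" "1 < q" "coprime p q"
  shows "threshold k T3 m"
  unfolding threshold_def
proof
  fix H :: "(real \<times> real \<times> real) hypergraph" assume "H \<in> T3"
  then obtain V E where H: "H = (V, E)" "finite V"
    and E: "\<And>e. e \<in> E \<Longrightarrow> \<exists>x0 y0 z0. e = V \<inter> {(x, y, z). x0 \<le> x \<and> y \<le> y0 \<and> z \<le> z0}"
    unfolding T3_def by fast
  define Y where "Y v = fst (snd v)" for v :: "real \<times> real \<times> real"
  define Z where "Z v = snd (snd v)" for v :: "real \<times> real \<times> real"
  define \<alpha> where "\<alpha> v = card {u\<in>V. Y v < Y u}" for v
  define \<beta> where "\<beta> v = card {u\<in>V. Z v < Z u}" for v
  obtain f where inj: "inj_on f V" and mono: "\<forall>u\<in>V. \<forall>v\<in>V. fst u < fst v \<longrightarrow> f u < f v"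
    and f: "\<forall>v\<in>V. \<exists>c. f v = (p ^ \<alpha> v * q ^ \<beta> v) * (1 + (p * q) * c)"
    using increasing_multiples[OF H(2), of "\<lambda>v. p ^ \<alpha> v * q ^ \<beta> v" "p * q" fst] pq by auto
  have dvd: "p ^ i * q ^ j dvd f v \<longleftrightarrow> i \<le> \<alpha> v \<and> j \<le> \<beta> v" if v: "v \<in> V" for v i j
  proof -
    obtain c where c: "f v = (p ^ \<alpha> v * q ^ \<beta> v) * (1 + (p * q) * c)" using f v by blast
    have "coprime p (1 + p * q * c)" "coprime q (1 + p * q * c)"
      using coprime_Suc_mult[of p "q * c"] coprime_Suc_mult[of q "p * c"] by (simp_all add: mult.assoc mult.left_commute)
    then have "coprime p (q ^ \<beta> v * (1 + p * q * c))" "coprime q (p ^ \<alpha> v * (1 + p * q * c))"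
      using pq(3) by (simp_all add: coprime_commute del: mult_Suc_right)
    then have "p ^ i dvd f v \<longleftrightarrow> i \<le> \<alpha> v" "q ^ j dvd f v \<longleftrightarrow> j \<le> \<beta> v"
      using power_dvd_power_mult_iff[OF pq(1), of "q ^ \<beta> v * (1 + p * q * c)" i "\<alpha> v"]
        power_dvd_power_mult_iff[OF pq(2), of "p ^ \<alpha> v * (1 + p * q * c)" j "\<beta> v"]
      unfolding c by (simp_all only: mult.assoc mult.left_commute)
    moreover have "coprime (p ^ i) (q ^ j)" using pq(3) by simp
    ultimately show ?thesis
      using divides_mult[of "p ^ i" "f v" "q ^ j"] dvd_mult_left dvd_mult_right by blast
  qed
  have "\<exists>c. polychromatic k (restrict_edges (V, E) m) c"
  proof (rule polychromatic_if_embeds_into_AP[OF threshold \<open>0 < m\<close> H(2) inj, of fst])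
    fix e assume "e \<in> E"
    then obtain x0 y0 z0 where "e = V \<inter> {(x, y, z). x0 \<le> x \<and> y \<le> y0 \<and> z \<le> z0}"
      using E by blast
    then have e: "e = {v\<in>V. x0 \<le> fst v \<and> Y v \<le> y0 \<and> Z v \<le> z0}"
      by (auto simp: Y_def Z_def)
    define i where "i = card {u\<in>V. y0 < Y u}"
    define j where "j = card {u\<in>V. z0 < Z u}"
    have "e = {v\<in>V. x0 \<le> fst v \<and> p ^ i * q ^ j dvd f v}"
      using dvd threshold_card_iff[OF H(2), of _ y0 Y] threshold_card_iff[OF H(2), of _ z0 Z]
      by (auto simp: e i_def j_def \<alpha>_def \<beta>_def)
    then show "\<exists>d\<in>{p ^ i * q ^ j | i j. True}. \<exists>x0. e = {v\<in>V. x0 \<le> fst v \<and> d dvd f v}"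
      by blast
  qed (use mono in blast)
  then show "\<exists>c. polychromatic k (restrict_edges H m) c" by (simp add: H(1))
qed

section \<open>Three coprime bases\<close>

text \<open>The leaves below \<open>u\<close> in the \<open>m\<close>-ary tree of depth \<open>D\<close> occupy the positions from \<open>pos m D u\<close> to
  \<open>pos m D u + m ^ (D - length u) - 1\<close>.\<close>

fun pos :: "nat \<Rightarrow> nat \<Rightarrow> nat list \<Rightarrow> nat" where
  "pos m D [] = 0"
| "pos m D (a # u) = a * m ^ (D - 1) + pos m (D - 1) u"

lemma pos_less: "set u \<subseteq> {..<m} \<Longrightarrow> length u \<le> D \<Longrightarrow> pos m D u + m ^ (D - length u) \<le> m ^ D"
proof (induction u arbitrary: D)
  case (Cons a u)
  then obtain D' where D: "D = Suc D'" by (cases D) auto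
  have "pos m D' u + m ^ (D' - length u) \<le> m ^ D'" using Cons D by simp
  moreover have "Suc a * m ^ D' \<le> m * m ^ D'" using Cons.prems(1) by (intro mult_right_mono) auto
  ultimately show ?case by (simp add: D)
qed simp

text \<open>Words are read as numbers in base \<open>m\<close>: the words of length \<open>D\<close>
  with prefix \<open>u\<close> fill a block of \<open>m ^ (D - length u)\<close> consecutive
  numbers.\<close>

lemma pos_prefix_iff:
  assumes "set u \<subseteq> {..<m}" "length u \<le> D" "set l \<subseteq> {..<m}" "length l = D"
  shows "pos m D u \<le> pos m D l \<and> pos m D l < pos m D u + m ^ (D - length u) \<longleftrightarrow> u = take (length u) l"
  using assms
proof (induction u arbitrary: D l)
  case Nil
  then have "pos m D l + 1 \<le> m ^ D" using pos_less[of l m D] by simp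
  then show ?case by simp
next
  case (Cons a u)
  then obtain D' where D: "D = Suc D'" by (cases D) auto
  obtain b l' where l: "l = b # l'" using Cons.prems(4) D by (cases l) auto
  have u: "pos m D' u + m ^ (D' - length u) \<le> m ^ D'" using pos_less[of u m D'] Cons.prems D by simp
  have l': "pos m D' l' < m ^ D'" using pos_less[of l' m D'] Cons.prems D l by simp
  show ?case
  proof (cases rule: linorder_cases[of a b])
    case less
    then have "Suc a * m ^ D' \<le> b * m ^ D'" by (intro mult_right_mono) auto
    then show ?thesis using less u by (simp add: D l)
  next
    case greater
    then have "Suc b * m ^ D' \<le> a * m ^ D'" by (intro mult_right_mono) auto
    then show ?thesis using greater l' by (simp add: D l)
  next
    case equal
    then show ?thesis using Cons.IH[of D' l'] Cons.prems by (simp add: D l)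
  qed
qed

section \<open>The tree and its colorings\<close>

definition tree :: "nat \<Rightarrow> nat list set" where
  "tree m = {u. set u \<subseteq> {..<m} \<and> length u < m}"

definition children :: "nat \<Rightarrow> nat list \<Rightarrow> nat list set" where
  "children m u = {u @ [a] | a. a < m}"

definition ancestors :: "nat list \<Rightarrow> nat list set" where
  "ancestors l = {take j l | j. j \<le> length l}"

text \<open>With \<open>m\<close> levels and \<open>m\<close> children per inner vertex, sibling
  sets and root-to-leaf paths all have exactly \<open>m\<close> elements, so no edge is deleted at
  threshold \<open>m\<close>.\<close>

definition tree_edges :: "nat \<Rightarrow> nat list set set" where
  "tree_edges m = {children m u | u. u \<in> tree m \<and> Suc (length u) < m} \<union>
     {ancestors l | l. l \<in> tree m \<and> Suc (length l) = m}"

lemma finite_tree: "finite (tree m)"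
  unfolding tree_def by (rule finite_subset[OF _ finite_lists_length_le[of "{..<m}" m]]) auto

text \<open>Descend from the root to children of the color of the root.\<close>

lemma tree_not_polychromatic:
  assumes "0 < m" "2 \<le> k"
  shows "\<not> polychromatic k (restrict_edges (tree m, tree_edges m) m) c"
proof
  assume c: "polychromatic k (restrict_edges (tree m, tree_edges m) m) c"
  define i where "i = c []"
  have i: "i < k" using c assms by (auto simp: polychromatic_def restrict_edges_def tree_def i_def)
  have edge: "\<exists>v\<in>e. c v = i'" if "e \<in> tree_edges m" "m \<le> card e" "i' < k" for e i'
    using c that by (auto simp: polychromatic_def restrict_edges_def)
  have "\<exists>u\<in>tree m. length u = j \<and> (\<forall>v\<in>ancestors u. c v = i)" if "j < m" for j
    using that
  proof (induction j)
    case 0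
    then show ?case by (intro bexI[of _ "[]"]) (auto simp: tree_def ancestors_def i_def)
  next
    case (Suc j)
    then obtain u where u: "u \<in> tree m" "length u = j" "\<forall>v\<in>ancestors u. c v = i" by auto
    have "children m u = (\<lambda>a. u @ [a]) ` {..<m}" by (auto simp: children_def)
    then have "card (children m u) = m" by (simp add: card_image inj_on_def)
    moreover have "children m u \<in> tree_edges m"
      using u Suc.prems by (auto simp: tree_edges_def)
    ultimately obtain a where a: "a < m" "c (u @ [a]) = i"
      using edge[of "children m u" i] i by (auto simp: children_def)
    have "ancestors (u @ [a]) = insert (u @ [a]) (ancestors u)"
      by (force simp: ancestors_def le_Suc_eq)
    then show ?case
      using u a Suc.prems by (intro bexI[of _ "u @ [a]"]) (auto simp: tree_def)
  qed
  then obtain l where l: "l \<in> tree m" "length l = m - 1" "\<forall>v\<in>ancestors l. c v = i"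
    using assms(1) by (metis diff_less zero_less_one)
  have "ancestors l = (\<lambda>j. take j l) ` {..m - 1}" by (auto simp: ancestors_def l(2))
  moreover have "inj_on (\<lambda>j. take j l) {..m - 1}"
    by (rule inj_onI) (metis atMost_iff l(2) length_take min.absorb2)
  ultimately have "card (ancestors l) = m" using assms(1) by (simp add: card_image)
  moreover have "ancestors l \<in> tree_edges m"
    using l assms(1) by (auto simp: tree_edges_def)
  moreover obtain i' where "i' < k" "i' \<noteq> i"
    using assms(2) by (metis One_nat_def Suc_1 Suc_le_lessD less_le_trans zero_less_Suc zero_neq_one lessI)
  ultimately show False using edge[of "ancestors l" i'] l(3) by auto
qed

text \<open>Sibling sets are intervals of the order by parents (key \<open>\<kappa>\<close> from below, \<open>p1\<close> from above);
  ancestor sets are the sets of all vertices whose interval of leaves contains a given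
  leaf (\<open>p2\<close> and \<open>p3\<close>).\<close>

lemma tree_polychromatic_if_threshold:
  assumes threshold: "threshold k (AP_inf {p1 ^ j1 * p2 ^ j2 * p3 ^ j3 | j1 j2 j3. True} {0}) m" and "0 < m"
    and p: "1 < p1" "1 < p2" "1 < p3" "coprime p1 p2" "coprime p1 p3" "coprime p2 p3"
  shows "\<exists>c. polychromatic k (restrict_edges (tree m, tree_edges m) m) c"
proof -
  let ?V = "tree m" and ?D = "m - 1"
  \<comment> \<open>Siblings share the code of their parent as key; the successor keeps 0 for the
    root alone.\<close>
  define \<kappa> :: "nat list \<Rightarrow> nat" where "\<kappa> v = (if v = [] then 0 else Suc (to_nat (butlast v)))" for v
  define B where "B = Max (\<kappa> ` ?V)"
  have B: "\<kappa> v \<le> B" if "v \<in> ?V" for v using that by (simp add: B_def finite_tree)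
  \<comment> \<open>The subtractions here and in \<open>\<alpha>2\<close> reverse an order, since
    divisibility bounds exponents from below. On the tree, \<open>B\<close> and
    \<open>m ^ ?D\<close> are upper bounds of the subtrahends, so nothing is truncated.\<close>
  define \<alpha>1 where "\<alpha>1 v = B - \<kappa> v" for v
  define \<alpha>2 where "\<alpha>2 v = m ^ ?D - pos m ?D v" for v
  define \<alpha>3 where "\<alpha>3 v = pos m ?D v + m ^ (?D - length v)" for v
  obtain f where inj: "inj_on f ?V" and mono: "\<forall>u\<in>?V. \<forall>v\<in>?V. \<kappa> u < \<kappa> v \<longrightarrow> f u < f v"
    and f: "\<forall>v\<in>?V. \<exists>c. f v = (p1 ^ \<alpha>1 v * p2 ^ \<alpha>2 v * p3 ^ \<alpha>3 v) * (1 + (p1 * p2 * p3) * c)"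
    using increasing_multiples[OF finite_tree, of "\<lambda>v. p1 ^ \<alpha>1 v * p2 ^ \<alpha>2 v * p3 ^ \<alpha>3 v" "p1 * p2 * p3" m \<kappa>] p
    by auto
  have dvd: "p1 ^ i dvd f v \<longleftrightarrow> i \<le> \<alpha>1 v" "p2 ^ i dvd f v \<longleftrightarrow> i \<le> \<alpha>2 v" "p3 ^ i dvd f v \<longleftrightarrow> i \<le> \<alpha>3 v"
    if v: "v \<in> ?V" for v i
  proof -
    obtain c where c: "f v = (p1 ^ \<alpha>1 v * p2 ^ \<alpha>2 v * p3 ^ \<alpha>3 v) * (1 + (p1 * p2 * p3) * c)"
      using f v by blast
    define s where "s = 1 + (p1 * p2 * p3) * c"
    have "coprime p1 s" "coprime p2 s" "coprime p3 s"
      using coprime_Suc_mult[of p1 "p2 * p3 * c"] coprime_Suc_mult[of p2 "p1 * p3 * c"]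
        coprime_Suc_mult[of p3 "p1 * p2 * c"] by (simp_all add: s_def ac_simps)
    moreover have "coprime p2 p1" "coprime p3 p1" "coprime p3 p2"
      using p by (simp_all add: coprime_commute)
    ultimately have cop: "coprime p1 (p2 ^ \<alpha>2 v * p3 ^ \<alpha>3 v * s)"
      "coprime p2 (p1 ^ \<alpha>1 v * p3 ^ \<alpha>3 v * s)" "coprime p3 (p1 ^ \<alpha>1 v * p2 ^ \<alpha>2 v * s)"
      using p by simp_all
    have fv: "f v = p1 ^ \<alpha>1 v * (p2 ^ \<alpha>2 v * p3 ^ \<alpha>3 v * s)"
      "f v = p2 ^ \<alpha>2 v * (p1 ^ \<alpha>1 v * p3 ^ \<alpha>3 v * s)" "f v = p3 ^ \<alpha>3 v * (p1 ^ \<alpha>1 v * p2 ^ \<alpha>2 v * s)"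
      by (simp_all only: c s_def ac_simps)
    show "p1 ^ i dvd f v \<longleftrightarrow> i \<le> \<alpha>1 v"
      unfolding fv(1) by (rule power_dvd_power_mult_iff[OF p(1) cop(1)])
    show "p2 ^ i dvd f v \<longleftrightarrow> i \<le> \<alpha>2 v"
      unfolding fv(2) by (rule power_dvd_power_mult_iff[OF p(2) cop(2)])
    show "p3 ^ i dvd f v \<longleftrightarrow> i \<le> \<alpha>3 v"
      unfolding fv(3) by (rule power_dvd_power_mult_iff[OF p(3) cop(3)])
  qed
  show ?thesis
  proof (rule polychromatic_if_embeds_into_AP[OF threshold \<open>0 < m\<close> finite_tree inj, of \<kappa>])
    fix e assume "e \<in> tree_edges m"
    then consider u where "u \<in> ?V" "Suc (length u) < m" "e = children m u"
      | l where "l \<in> ?V" "Suc (length l) = m" "e = ancestors l"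
      unfolding tree_edges_def by blast
    then show "\<exists>d\<in>{p1 ^ j1 * p2 ^ j2 * p3 ^ j3 | j1 j2 j3. True}. \<exists>\<kappa>0.
        e = {v\<in>?V. \<kappa>0 \<le> \<kappa> v \<and> d dvd f v}"
    proof cases
      case 1
      let ?\<kappa>0 = "Suc (to_nat u)"
      have "u @ [0] \<in> ?V" using 1 \<open>0 < m\<close> by (auto simp: tree_def)
      then have \<kappa>0: "?\<kappa>0 \<le> B" using B[of "u @ [0]"] by (simp add: \<kappa>_def)
      have "v \<in> children m u \<longleftrightarrow> ?\<kappa>0 \<le> \<kappa> v \<and> p1 ^ (B - ?\<kappa>0) dvd f v" if v: "v \<in> ?V" for v
      proof -
        have "p1 ^ (B - ?\<kappa>0) dvd f v \<longleftrightarrow> \<kappa> v \<le> ?\<kappa>0"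
          unfolding dvd(1)[OF v] \<alpha>1_def using \<kappa>0 B[OF v] by linarith
        then have "?\<kappa>0 \<le> \<kappa> v \<and> p1 ^ (B - ?\<kappa>0) dvd f v \<longleftrightarrow> \<kappa> v = ?\<kappa>0" by linarith
        also have "\<dots> \<longleftrightarrow> v \<noteq> [] \<and> butlast v = u" by (simp add: \<kappa>_def)
        also have "\<dots> \<longleftrightarrow> v \<in> children m u"
          using v by (cases v rule: rev_cases) (auto simp: children_def tree_def)
        finally show ?thesis by blast
      qed
      moreover have "children m u \<subseteq> ?V" using 1 by (auto simp: children_def tree_def)
      ultimately have "e = {v\<in>?V. ?\<kappa>0 \<le> \<kappa> v \<and> p1 ^ (B - ?\<kappa>0) * p2 ^ 0 * p3 ^ 0 dvd f v}"
        unfolding 1(3) by auto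
      then show ?thesis by blast
    next
      case 2
      let ?i = "m ^ ?D - pos m ?D l" and ?j = "Suc (pos m ?D l)"
      have l: "set l \<subseteq> {..<m}" "length l = ?D" using 2 by (auto simp: tree_def)
      have "v \<in> ancestors l \<longleftrightarrow> p2 ^ ?i * p3 ^ ?j dvd f v" if v: "v \<in> ?V" for v
      proof -
        have v': "set v \<subseteq> {..<m}" "length v \<le> ?D" using v by (auto simp: tree_def)
        have "coprime (p2 ^ ?i) (p3 ^ ?j)" using p(6) by simp
        then have "p2 ^ ?i * p3 ^ ?j dvd f v \<longleftrightarrow> p2 ^ ?i dvd f v \<and> p3 ^ ?j dvd f v"
          using divides_mult[of "p2 ^ ?i" "f v" "p3 ^ ?j"] dvd_mult_left[of "p2 ^ ?i" "p3 ^ ?j" "f v"]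
            dvd_mult_right[of "p2 ^ ?i" "p3 ^ ?j" "f v"] by blast
        also have "\<dots> \<longleftrightarrow> pos m ?D v \<le> pos m ?D l \<and> pos m ?D l < pos m ?D v + m ^ (?D - length v)"
          unfolding dvd(2,3)[OF v] \<alpha>2_def \<alpha>3_def
          using pos_less[OF v'] pos_less[OF l(1) eq_imp_le[OF l(2)]] by linarith
        also have "\<dots> \<longleftrightarrow> v = take (length v) l" by (rule pos_prefix_iff[OF v' l])
        also have "\<dots> \<longleftrightarrow> v \<in> ancestors l" using v' l by (auto simp: ancestors_def)
        finally show ?thesis by blast
      qed
      moreover have "ancestors l \<subseteq> ?V" using 2 by (auto simp: ancestors_def tree_def dest: in_set_takeD)
      ultimately have "e = {v\<in>?V. 0 \<le> \<kappa> v \<and> p1 ^ 0 * p2 ^ ?i * p3 ^ ?j dvd f v}"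
        unfolding 2(3) by auto
      then show ?thesis by blast
    qed
  qed (use mono in blast)
qed

section \<open>The polychromatic numbers\<close>

lemma poly_number_AP_inf_incongruent_le:
  assumes "0 < k" and pq: "1 < p" "1 < q" "coprime p q"
    and inj: "\<forall>x\<in>M. \<forall>y\<in>M. [x = y] (mod p * q) \<longrightarrow> x = y"
  shows "poly_number (AP_inf {p ^ i * q ^ j | i j. True} M) k
    \<le> enat (card M) * (poly_number T3 k - 1) + 1"
proof (cases "M = {}")
  \<comment> \<open>There are no edges at all, so 1 is a threshold; the right-hand side is 1 too,
    since 0 times infinity is 0 in \<open>enat\<close>.\<close>
  case True
  have "threshold k (AP_inf {p ^ i * q ^ j | i j. True} {}) 1"
    using \<open>0 < k\<close> by (force simp: threshold_def AP_inf_def polychromatic_def restrict_edges_def)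
  then have "poly_number (AP_inf {p ^ i * q ^ j | i j. True} {}) k \<le> enat 1"
    by (rule threshold_imp_poly_number_le[rotated]) simp
  then show ?thesis by (simp add: True zero_enat_def[symmetric] one_enat_def)
next
  case False
  \<comment> \<open>Finiteness matters because \<open>card\<close> is 0 on infinite sets.\<close>
  have "inj_on (\<lambda>x. x mod (p * q)) M" using inj by (auto simp: inj_on_def cong_def)
  moreover have "(\<lambda>x. x mod (p * q)) ` M \<subseteq> {..<p * q}" using pq by auto
  ultimately have fin: "finite M" by (meson finite_lessThan inj_on_finite)
  show ?thesis
  proof (cases rule: poly_number_cases[of T3 k])
    case 1
    then show ?thesis using False fin by (simp add: enat_0_iff)
  next
    case (2 m)
    then have "poly_number (AP_inf {p ^ i * q ^ j | i j. True} M) k \<le> enat (card M * (m - 1) + 1)"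
      using threshold_AP_inf_incongruent[OF 2(3,2) pq fin False] inj
      by (intro threshold_imp_poly_number_le) auto
    then show ?thesis using 2 by (simp add: one_enat_def)
  qed
qed

theorem theorem6:
  fixes k :: nat
  assumes "0 < k"
  shows
    "(\<forall>t::nat. 2 \<le> t \<longrightarrow>
        poly_number (AP_inf {t ^ i | i. True} UNIV) k \<le> poly_number T3 k)
     \<and>
     (\<forall>p q :: nat. 1 < p \<longrightarrow> 1 < q \<longrightarrow> coprime p q \<longrightarrow>
        (\<forall>M :: nat set. (\<forall>x\<in>M. \<forall>y\<in>M. [x = y] (mod p * q) \<longrightarrow> x = y) \<longrightarrow>
           poly_number (AP_inf {p ^ i * q ^ j | i j. True} M) k
             \<le> enat (card M) * (poly_number T3 k - 1) + 1)
        \<and> poly_number (AP_inf {p ^ i * q ^ j | i j. True} {0}) k = poly_number T3 k)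
     \<and>
     (2 \<le> k \<longrightarrow>
        (\<forall>p1 p2 p3 :: nat. 1 < p1 \<longrightarrow> 1 < p2 \<longrightarrow> 1 < p3 \<longrightarrow>
           coprime p1 p2 \<longrightarrow> coprime p1 p3 \<longrightarrow> coprime p2 p3 \<longrightarrow>
           poly_number (AP_inf {p1 ^ j1 * p2 ^ j2 * p3 ^ j3 | j1 j2 j3. True} {0}) k = \<infinity>))"
proof (intro conjI allI impI)
  fix t :: nat assume "2 \<le> t"
  then show "poly_number (AP_inf {t ^ i | i. True} UNIV) k \<le> poly_number T3 k"
    by (intro poly_number_mono threshold_AP_inf_powers)
next
  fix p q :: nat and M :: "nat set"
  assume "1 < p" "1 < q" "coprime p q" "\<forall>x\<in>M. \<forall>y\<in>M. [x = y] (mod p * q) \<longrightarrow> x = y"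
  then show "poly_number (AP_inf {p ^ i * q ^ j | i j. True} M) k
      \<le> enat (card M) * (poly_number T3 k - 1) + 1"
    by (rule poly_number_AP_inf_incongruent_le[OF assms])
next
  fix p q :: nat assume pq: "1 < p" "1 < q" "coprime p q"
  show "poly_number (AP_inf {p ^ i * q ^ j | i j. True} {0}) k = poly_number T3 k"
  proof (rule antisym)
    show "poly_number T3 k \<le> poly_number (AP_inf {p ^ i * q ^ j | i j. True} {0}) k"
      using threshold_T3_if_threshold_AP pq by (intro poly_number_mono) blast
    \<comment> \<open>For a single offset the bound \<open>1 * (m - 1) + 1\<close> is
      \<open>m\<close> itself.\<close>
    have "threshold k (AP_inf {p ^ i * q ^ j | i j. True} {0}) m" if "0 < m" "threshold k T3 m" for m
      using threshold_AP_inf_incongruent[OF that(2,1) pq, of "{0}"] that(1) by simp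
    then show "poly_number (AP_inf {p ^ i * q ^ j | i j. True} {0}) k \<le> poly_number T3 k"
      by (rule poly_number_mono)
  qed
next
  fix p1 p2 p3 :: nat
  assume k: "2 \<le> k" and p: "1 < p1" "1 < p2" "1 < p3" "coprime p1 p2" "coprime p1 p3" "coprime p2 p3"
  let ?A = "AP_inf {p1 ^ j1 * p2 ^ j2 * p3 ^ j3 | j1 j2 j3. True} {0}"
  show "poly_number ?A k = \<infinity>"
  proof (cases rule: poly_number_cases[of ?A k])
    case (2 m)
    then show ?thesis using tree_polychromatic_if_threshold[OF 2(3,2) p] tree_not_polychromatic[OF 2(2) k] by blast
  qed
qed

end
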